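(* Let $\Omega\subseteq\mathbb{C}$ be an open set with $0\in\Omega$ such that $(\mathbb{C}\cup\{\infty\})\setminus\overline{\Omega}$ is connected, where $\overline\Omega$ denotes the closure of $\Omega$ in $\mathbb{C}$. Let $F\subseteq\mathbb{N}\times\mathbb{N}$ be a set which contains a sequence $(\widetilde p_m,\widetilde q_m)_{m}$ with $\widetilde p_m\to+\infty$. Let $B_F$ be the set of all $f\in A^\infty(\Omega)$ for which there exists a sequence $(p_m,q_m)_m$ in $F$ such that $f\in D_{p_m,q_m}$ for all $m$, and such that for every compact set $K\subseteq\overline\Omega$ and every $l=0,1,2,\ldots$ one has $[p_m/q_m]_f^{(l)}\to f^{(l)}$ uniformly on $K$ as $m\to\infty$. Let $X$ be the closure of $H(\overline\Omega)$ in $A^\infty(\Omega)$, with the relative topology. Then $B_F\cap X$ is a dense $G_\delta$ subset of $X$. (Hence $B_F\neq\emptyset$.)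
   Context: $\mathbb{N}=\{0,1,2,\ldots\}$. $\Delta(0,r)=\{z\in\mathbb{C}:|z|<r\}$. **The space $A^\infty(\Omega)$.** $A^\infty(\Omega)$ is the set of holomorphic functions $f$ on $\Omega$ such that for every $l=0,1,2,\ldots$ the derivative $f^{(l)}$ extends continuously to $\overline\Omega$ (the extension is again denoted $f^{(l)}$). For $n\ge 1$ and $l\ge 0$ put $\|f-g\|_{l,n}=\sup_{z\in\overline\Omega\cap\overline{\Delta(0,n)}}|f^{(l)}(z)-g^{(l)}(z)|$. $A^\infty(\Omega)$ carries the complete metric $\rho(f,g)=\sum_{l=0}^\infty\sum_{n=1}^\infty 2^{-(l+n)}\min\{\|f-g\|_{l,n},1\}$; convergence means uniform convergence of every derivative on every compact subset of $\overline\Omega$. **The space $H(\overline\Omega)$.** $H(\overline\Omega)$ is the set of functions holomorphic in some open set (depending on the function) containing $\overline\Omega$. It is regarded, by restriction to $\Omega$, as a subset of $A^\infty(\Omega)$. **Padé approximants.** Let $f$ be holomorphic near $0$ with Taylor series $\sum_{v\ge0}a_vz^v$, and set $a_i=0$ for $i<0$. For $p,q\in\mathbb{N}$, a Padé approximant $[p/q]_f$ is a rational function $\frac{\sum_{v=0}^p n_vz^v}{\sum_{v=0}^q d_vz^v}$ with $d_0=1$ whose Taylor coefficients $b_v$ at $0$ satisfy $b_v=a_v$ for $v=0,\ldots,p+q$. For $q\ge1$, $f\in D_{p,q}$ means that the $q\times q$ determinant $\det(a_{p-q+i+j-1})_{1\le i,j\le q}$ is nonzero; in this case $[p/q]_f$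 exists and is unique. For $q=0$, every such $f$ belongs to $D_{p,0}$, and $[p/0]_f=\sum_{v=0}^p a_vz^v$. **Convention on poles.** Uniform convergence of $[p_m/q_m]_f^{(l)}$ on $K$ is understood with $|[p_m/q_m]_f^{(l)}-f^{(l)}|=\infty$ at poles, so in particular $[p_m/q_m]_f$ has no poles in $K$ for all sufficiently large $m$. *)

theory Defs
  imports
    "HOL-Complex_Analysis.Complex_Analysis"
    "HOL-Computational_Algebra.Computational_Algebra"
    "HOL-Computational_Algebra.Field_as_Ring"
    "Jordan_Normal_Form.Determinant"
begin

text \<open>A function on \<open>\<Omega>\<close> is represented by a total function that is \<open>undefined\<close> outside \<open>\<Omega>\<close>,
  so that equality of representatives is equality of functions on \<open>\<Omega>\<close>.\<close>

definition A_infty :: "complex set \<Rightarrow> (complex \<Rightarrow> complex) set" where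
  "A_infty \<Omega> = {f \<in> extensional \<Omega>. f holomorphic_on \<Omega> \<and>
     (\<forall>l. \<exists>g. continuous_on (closure \<Omega>) g \<and> (\<forall>z\<in>\<Omega>. g z = (deriv ^^ l) f z))}"

text \<open>The continuous extension of the \<open>l\<close>-th derivative to \<open>closure \<Omega>\<close>. For \<open>f \<in> A_infty \<Omega>\<close> with
  \<open>\<Omega>\<close> open, the limit exists at every point of \<open>closure \<Omega>\<close>, and at points of \<open>\<Omega>\<close> it is the
  derivative itself.\<close>

definition deriv_ext :: "complex set \<Rightarrow> nat \<Rightarrow> (complex \<Rightarrow> complex) \<Rightarrow> complex \<Rightarrow> complex" where
  "deriv_ext \<Omega> l f z = Lim (at z within \<Omega>) ((deriv ^^ l) f)"

definition A_infty_dist ::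
    "complex set \<Rightarrow> nat \<Rightarrow> nat \<Rightarrow> (complex \<Rightarrow> complex) \<Rightarrow> (complex \<Rightarrow> complex) \<Rightarrow> real" where
  "A_infty_dist \<Omega> l n f g =
     (SUP z\<in>closure \<Omega> \<inter> cball 0 (real n). cmod (deriv_ext \<Omega> l f z - deriv_ext \<Omega> l g z))"

text \<open>The index \<open>n\<close> below runs from \<open>0\<close>, so that \<open>Suc n\<close> runs over the \<open>n \<ge> 1\<close>.
  The guard is needed because the locale \<open>Metric_space\<close> requires nonnegativity and symmetry of
  the distance also for arguments outside the carrier.\<close>

definition A_infty_metric ::
    "complex set \<Rightarrow> (complex \<Rightarrow> complex) \<Rightarrow> (complex \<Rightarrow> complex) \<Rightarrow> real" where
  "A_infty_metric \<Omega> f g =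
     (if f \<in> A_infty \<Omega> \<and> g \<in> A_infty \<Omega>
      then \<Sum>l. \<Sum>n. (1/2) ^ (l + Suc n) * min (A_infty_dist \<Omega> l (Suc n) f g) 1
      else 0)"

definition A_infty_topology :: "complex set \<Rightarrow> (complex \<Rightarrow> complex) topology" where
  "A_infty_topology \<Omega> = Metric_space.mtopology (A_infty \<Omega>) (A_infty_metric \<Omega>)"

definition H_closure :: "complex set \<Rightarrow> (complex \<Rightarrow> complex) set" where
  "H_closure \<Omega> = {restrict h \<Omega> | h. \<exists>U. open U \<and> closure \<Omega> \<subseteq> U \<and> h holomorphic_on U}"

text \<open>Rational functions are elements of the field of fractions of \<open>\<complex>[z]\<close>; they are evaluated
  through their reduced numerator and denominator, so removable singularities are removed.\<close>

definition rat_eval :: "complex poly fract \<Rightarrow> complex \<Rightarrow> complex" where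
  "rat_eval r z = poly (fst (quot_of_fract r)) z / poly (snd (quot_of_fract r)) z"

definition rat_poles :: "complex poly fract \<Rightarrow> complex set" where
  "rat_poles r = {z. poly (snd (quot_of_fract r)) z = 0}"

definition is_pade :: "(complex \<Rightarrow> complex) \<Rightarrow> nat \<Rightarrow> nat \<Rightarrow> complex poly fract \<Rightarrow> bool" where
  "is_pade f p q r \<longleftrightarrow>
     (\<exists>P Q. degree P \<le> p \<and> degree Q \<le> q \<and> poly.coeff Q 0 = 1 \<and> r = Fraction_Field.Fract P Q) \<and>
     (\<forall>v\<le>p + q. fps_nth (fps_expansion (rat_eval r) 0) v = fps_nth (fps_expansion f 0) v)"

definition pade :: "(complex \<Rightarrow> complex) \<Rightarrow> nat \<Rightarrow> nat \<Rightarrow> complex poly fract" where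
  "pade f p q = (THE r. is_pade f p q r)"

definition taylor_coeff :: "(complex \<Rightarrow> complex) \<Rightarrow> int \<Rightarrow> complex" where
  "taylor_coeff f i = (if i < 0 then 0 else fps_nth (fps_expansion f 0) (nat i))"

text \<open>Rows and columns are indexed from \<open>0\<close>, hence \<open>+ 1\<close> instead of \<open>- 1\<close> in the entries.\<close>

definition pade_regular :: "(complex \<Rightarrow> complex) \<Rightarrow> nat \<Rightarrow> nat \<Rightarrow> bool" where
  "pade_regular f p q \<longleftrightarrow>
     q = 0 \<or>
     Determinant.det (Matrix.mat q q
       (\<lambda>(i, j). taylor_coeff f (int p - int q + int i + int j + 1))) \<noteq> 0"

definition pade_convergent :: "complex set \<Rightarrow> (nat \<times> nat) set \<Rightarrow> (complex \<Rightarrow> complex) set" where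
  "pade_convergent \<Omega> F = {f \<in> A_infty \<Omega>. \<exists>p q :: nat \<Rightarrow> nat.
     (\<forall>m. (p m, q m) \<in> F \<and> pade_regular f (p m) (q m)) \<and>
     (\<forall>K l. compact K \<and> K \<subseteq> closure \<Omega> \<longrightarrow>
        (\<forall>\<^sub>F m in sequentially. K \<inter> rat_poles (pade f (p m) (q m)) = {}) \<and>
        uniform_limit K (\<lambda>m. (deriv ^^ l) (rat_eval (pade f (p m) (q m))))
          (deriv_ext \<Omega> l f) sequentially)}"

end

theory Submission
  imports Defs
begin

text \<open>The set of Pade-convergent functions is \<open>\<Inter>s. \<Union>(p,q)\<in>F. G s p q\<close>, where \<open>G s p q\<close> consists of
  the functions in \<open>D\<^sub>p\<^sub>,\<^sub>q\<close> whose \<open>[p/q]\<close> approximant has no poles on \<open>closure \<Omega> \<inter> cball 0 s\<close> and is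
  closer than \<open>1/(s+1)\<close> to the function there, together with its derivatives up to order \<open>s\<close>.
  These sets are open: by Cramer's rule the coefficients of the approximant depend continuously on
  the Taylor coefficients while the Hankel determinant does not vanish. Their unions over \<open>F\<close> are
  dense in \<open>X\<close>: by Runge's theorem polynomials are dense in \<open>X\<close>, and a polynomial of degree
  exactly \<open>p\<close> is its own \<open>[p/q]\<close> approximant for every \<open>q\<close>. Baire's theorem in the complete
  space \<open>X\<close> concludes.\<close>

section \<open>Cauchy integrals over a grid\<close>

text \<open>The closure of the domain may be unbounded and its boundary is arbitrary, so everything
  is tested on its compact intersections \<open>trunc n\<close> with discs. Uniform convergence on
  such a piece says nothing about derivatives at its boundary points; therefore Runge's theorem and
  the convergence of the rational functions are proved on a neighbourhood of the piece, where
  Cauchy's estimates control all derivatives. The connectedness hypothesis concerns the sphere and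
  is converted into connectedness of the planar complement of each piece. Runge's theorem rests on a
  Cauchy formula over finitely many segments, whose Riemann sums have poles that geometric series
  move far away. On the Pade side the obstacle is that reducing a fraction may cancel factors, so
  poles need not vary continuously. In the regular case uniqueness removes it: the reduced
  normalised fraction solves the same linear system, so the poles are exactly the zeros of the
  Cramer denominator. Baire's theorem is applied in X because approximation by polynomials starts
  from functions holomorphic across the boundary.\<close>

lemma continuous_on_contour_integral_Cauchy_kernel:
  assumes "continuous_on (closed_segment a b) f" "open S" "S \<inter> closed_segment a b = {}"
  shows "continuous_on S (\<lambda>z. contour_integral (linepath a b) (\<lambda>w. f w / (w - z)))"
proof (rule continuous_at_imp_continuous_on, rule ballI)
  fix z assume z: "z \<in> S"
  have int: "((\<lambda>u. f u / (u - w) ^ 1) has_contour_integral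
      contour_integral (linepath a b) (\<lambda>u. f u / (u - w))) (linepath a b)"
    if "w \<in> S - path_image (linepath a b)" for w
  proof -
    have "continuous_on (closed_segment a b) (\<lambda>u. f u / (u - w))"
      using that by (intro continuous_intros assms) auto
    then show ?thesis
      by (simp add: contour_integrable_continuous_linepath has_contour_integral_integral)
  qed
  \<comment> \<open>The kernel with exponent 1 can be differentiated under the integral; only the
    resulting continuity is kept.\<close>
  have "((\<lambda>z. contour_integral (linepath a b) (\<lambda>u. f u / (u - z))) has_field_derivative
      (1 * contour_integral (linepath a b) (\<lambda>u. f u / (u - z) ^ Suc 1))) (at z)"
    using Cauchy_next_derivative(2)[of "linepath a b" f "norm (b - a)" S 1
        "\<lambda>z. contour_integral (linepath a b) (\<lambda>u. f u / (u - z))" z]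
    using assms int z by auto
  then show "isCont (\<lambda>z. contour_integral (linepath a b) (\<lambda>w. f w / (w - z))) z"
    using DERIV_isCont by blast
qed

text \<open>Summation by parts on an index grid: the shift moves from the values to the
  coefficients. \<open>T\<close> is not shift invariant, but it contains the support
  \<open>A\<close> of the coefficients and its translate, and all other terms vanish.\<close>

lemma sum_shift_finite_support:
  fixes \<sigma> H :: "'a \<Rightarrow> complex"
  assumes "finite T" "A \<subseteq> T" "s ` A \<subseteq> T" "\<And>p. p \<notin> A \<Longrightarrow> \<sigma> p = 0"
    "\<And>p. t (s p) = p" "\<And>p. s (t p) = p"
  shows "(\<Sum>p\<in>T. \<sigma> p * H (s p)) = (\<Sum>p\<in>T. \<sigma> (t p) * H p)"
proof -
  have "(\<Sum>p\<in>T. \<sigma> p * H (s p)) = (\<Sum>p\<in>A. \<sigma> p * H (s p))"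
    using assms by (intro sum.mono_neutral_right) auto
  also have "\<dots> = (\<Sum>p\<in>s ` A. \<sigma> (t p) * H p)"
    by (subst sum.reindex) (auto intro!: inj_on_inverseI[of _ t] simp: assms)
  also have "\<dots> = (\<Sum>p\<in>T. \<sigma> (t p) * H p)"
    using assms by (intro sum.mono_neutral_left) (auto, metis image_eqI)
  finally show ?thesis .
qed

text \<open>Opposite sides are traversed in the same direction and the orientation is put into the
  sign. A side shared by two squares then gives literally the same integral twice, with opposite
  signs.\<close>

lemma contour_integral_rectpath_edges:
  assumes "continuous_on (path_image (rectpath (Complex x y) (Complex x' y'))) g"
  shows "contour_integral (rectpath (Complex x y) (Complex x' y')) g =
     contour_integral (linepath (Complex x y) (Complex x' y)) g
   - contour_integral (linepath (Complex x y') (Complex x' y')) g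
   + contour_integral (linepath (Complex x' y) (Complex x' y')) g
   - contour_integral (linepath (Complex x y) (Complex x y')) g"
proof -
  let ?a = "Complex x y" and ?b = "Complex x' y" and ?c = "Complex x' y'" and ?d = "Complex x y'"
  have eq: "rectpath ?a ?c = linepath ?a ?b +++ linepath ?b ?c +++ linepath ?c ?d +++ linepath ?d ?a"
    by (simp add: rectpath_def Let_def)
  have "path_image (rectpath ?a ?c) = closed_segment ?a ?b \<union> (closed_segment ?b ?c \<union>
      (closed_segment ?c ?d \<union> closed_segment ?d ?a))"
    unfolding eq by (simp add: path_image_join)
  then have c: "continuous_on (closed_segment ?a ?b) g" "continuous_on (closed_segment ?b ?c) g"
    "continuous_on (closed_segment ?c ?d) g" "continuous_on (closed_segment ?d ?a) g"
    using assms(1) by (auto elim: continuous_on_subset)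
  note i = c[THEN contour_integrable_continuous_linepath]
  have "contour_integral (rectpath ?a ?c) g = contour_integral (linepath ?a ?b) g
      + (contour_integral (linepath ?b ?c) g + (contour_integral (linepath ?c ?d) g
      + contour_integral (linepath ?d ?a) g))"
    unfolding eq by (simp add: i)
  moreover have "contour_integral (linepath ?c ?d) g = - contour_integral (linepath ?d ?c) g"
    by (metis c(3) closed_segment_commute contour_integral_reverse_linepath)
  moreover have "contour_integral (linepath ?d ?a) g = - contour_integral (linepath ?a ?d) g"
    by (metis c(4) closed_segment_commute contour_integral_reverse_linepath)
  ultimately show ?thesis by simp
qed

section \<open>The square grid of mesh \<open>d\<close>\<close>

definition grid_point :: "real \<Rightarrow> int \<Rightarrow> int \<Rightarrow> complex" where
  "grid_point d i j = Complex (d * of_int i) (d * of_int j)"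

definition grid_square :: "real \<Rightarrow> int \<times> int \<Rightarrow> complex set" where
  "grid_square d = (\<lambda>(i, j). cbox (grid_point d i j) (grid_point d (i + 1) (j + 1)))"

lemma grid_square_iff:
  "z \<in> grid_square d (i, j) \<longleftrightarrow>
     d * of_int i \<le> Re z \<and> Re z \<le> d * of_int (i + 1) \<and> d * of_int j \<le> Im z \<and> Im z \<le> d * of_int (j + 1)"
  by (auto simp: grid_square_def grid_point_def in_cbox_complex_iff)

lemma horizontal_edge_subset_grid_square:
  assumes "d > 0"
  shows "closed_segment (grid_point d i j) (grid_point d (i + 1) j)
     \<subseteq> grid_square d (i, j) \<inter> grid_square d (i, j - 1)"
proof -
  have "convex (grid_square d p)" for p by (cases p) (simp add: grid_square_def)
  moreover have "grid_point d i j \<in> grid_square d (i, j) \<inter> grid_square d (i, j - 1)"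
    "grid_point d (i + 1) j \<in> grid_square d (i, j) \<inter> grid_square d (i, j - 1)"
    using assms by (auto simp: grid_square_iff grid_point_def algebra_simps)
  ultimately show ?thesis by (meson closed_segment_subset convex_Int)
qed

lemma vertical_edge_subset_grid_square:
  assumes "d > 0"
  shows "closed_segment (grid_point d i j) (grid_point d i (j + 1))
     \<subseteq> grid_square d (i, j) \<inter> grid_square d (i - 1, j)"
proof -
  have "convex (grid_square d p)" for p by (cases p) (simp add: grid_square_def)
  moreover have "grid_point d i j \<in> grid_square d (i, j) \<inter> grid_square d (i - 1, j)"
    "grid_point d i (j + 1) \<in> grid_square d (i, j) \<inter> grid_square d (i - 1, j)"
    using assms by (auto simp: grid_square_iff grid_point_def algebra_simps)
  ultimately show ?thesis by (meson closed_segment_subset convex_Int)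
qed

lemma finite_grid_squares_meeting:
  assumes "bounded K" "d > 0"
  shows "finite {p. grid_square d p \<inter> K \<noteq> {}}"
proof -
  obtain M where M: "\<And>z. z \<in> K \<Longrightarrow> norm z \<le> M" using assms(1) bounded_iff by blast
  \<comment> \<open>A square with index i extends up to d * (i + 1), so i may be as small as
    -ceiling(M / d) - 1; adding 2 leaves room for this.\<close>
  define N where "N = \<lceil>M / d\<rceil> + 2"
  have "{p. grid_square d p \<inter> K \<noteq> {}} \<subseteq> {-N..N} \<times> {-N..N}"
  proof
    fix p assume "p \<in> {p. grid_square d p \<inter> K \<noteq> {}}"
    then obtain i j z where p: "p = (i, j)" and z: "z \<in> grid_square d (i, j)" "z \<in> K"
      by (cases p) auto
    have "\<bar>Re z\<bar> \<le> M" "\<bar>Im z\<bar> \<le> M"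
      using M[OF z(2)] abs_Re_le_cmod abs_Im_le_cmod order_trans by blast+
    moreover have "M \<le> d * of_int \<lceil>M / d\<rceil>"
      using assms(2) by (metis le_of_int_ceiling mult.commute pos_divide_le_eq)
    ultimately have "d * of_int i \<le> d * of_int \<lceil>M / d\<rceil>" "d * of_int j \<le> d * of_int \<lceil>M / d\<rceil>"
       "- (d * of_int \<lceil>M / d\<rceil>) \<le> d * of_int (i + 1)" "- (d * of_int \<lceil>M / d\<rceil>) \<le> d * of_int (j + 1)"
      using z(1) unfolding grid_square_iff by linarith+
    then have "d * of_int i \<le> d * of_int \<lceil>M / d\<rceil>" "d * of_int j \<le> d * of_int \<lceil>M / d\<rceil>"
       "d * of_int (-\<lceil>M / d\<rceil>) \<le> d * of_int (i + 1)" "d * of_int (- \<lceil>M / d\<rceil>) \<le> d * of_int (j + 1)"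
      by auto
    then have "i \<le> \<lceil>M / d\<rceil>" "j \<le> \<lceil>M / d\<rceil>" "- \<lceil>M / d\<rceil> \<le> i + 1" "- \<lceil>M / d\<rceil> \<le> j + 1"
      using assms(2) unfolding mult_le_cancel_left_pos[OF assms(2)] of_int_le_iff by auto
    then show "p \<in> {-N..N} \<times> {-N..N}" unfolding N_def p by auto
  qed
  then show ?thesis using finite_subset by blast
qed

lemma grid_square_diameter:
  assumes "z \<in> grid_square d p" "w \<in> grid_square d p"
  shows "dist z w \<le> 2 * d"
proof -
  obtain i j where p: "p = (i, j)" by (cases p)
  have "\<bar>Re (z - w)\<bar> \<le> d" "\<bar>Im (z - w)\<bar> \<le> d"
    using assms unfolding p grid_square_iff by (auto simp: abs_le_iff algebra_simps)
  then show ?thesis using cmod_le[of "z - w"] by (simp add: dist_norm)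
qed

text \<open>Off all grid lines, a point of a closed square is interior to it, so the boundary winds
  around it once. For a point outside, the kernel is holomorphic on the whole convex square.\<close>

lemma contour_integral_grid_square:
  assumes "d > 0" "h holomorphic_on grid_square d (i, j)"
    "\<And>k. Re z \<noteq> d * of_int k" "\<And>k. Im z \<noteq> d * of_int k"
  shows "contour_integral (rectpath (grid_point d i j) (grid_point d (i + 1) (j + 1))) (\<lambda>w. h w / (w - z))
     = (if z \<in> grid_square d (i, j) then 2 * pi * \<i> * h z else 0)"
proof -
  let ?a = "grid_point d i j" and ?c = "grid_point d (i + 1) (j + 1)"
  have le: "Re ?a \<le> Re ?c" "Im ?a \<le> Im ?c" using assms(1) by (auto simp: grid_point_def)
  have sq: "grid_square d (i, j) = cbox ?a ?c" by (simp add: grid_square_def)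
  show ?thesis
  proof (cases "z \<in> cbox ?a ?c")
    case True
    then have z: "z \<in> box ?a ?c"
      using assms(3)[of i] assms(3)[of "i + 1"] assms(4)[of j] assms(4)[of "j + 1"]
      unfolding in_cbox_complex_iff in_box_complex_iff grid_point_def complex.sel
      by (auto simp: order_le_less)
    have "((\<lambda>w. h w / (w - z)) has_contour_integral
        (2 * pi * \<i> * winding_number (rectpath ?a ?c) z * h z)) (rectpath ?a ?c)"
    proof (rule Cauchy_integral_formula_convex_simple)
      show "h holomorphic_on cbox ?a ?c" using assms(2) sq by simp
      show "path_image (rectpath ?a ?c) \<subseteq> cbox ?a ?c - {z}"
        using path_image_rectpath_subset_cbox[OF le] path_image_rectpath_inter_box[OF le] z by blast
    qed (use z in \<open>auto simp: interior_cbox\<close>)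
    then show ?thesis
      using True winding_number_rectpath[OF z] sq contour_integral_unique by fastforce
  next
    case False
    have "((\<lambda>w. h w / (w - z)) has_contour_integral 0) (rectpath ?a ?c)"
    proof (rule Cauchy_theorem_convex_simple)
      show "(\<lambda>w. h w / (w - z)) holomorphic_on cbox ?a ?c"
        using assms(2) sq False by (intro holomorphic_intros) auto
      show "path_image (rectpath ?a ?c) \<subseteq> cbox ?a ?c" by (rule path_image_rectpath_subset_cbox[OF le])
    qed auto
    then show ?thesis using False sq by (simp add: contour_integral_unique)
  qed
qed

text \<open>The next multiple of d strictly above x is d * (floor(x / d) + 1); shifts that stop
  short of it meet no multiple.\<close>

lemma eventually_add_notin_multiples:
  fixes x d :: real
  assumes "d > 0"
  shows "\<forall>\<^sub>F t in at_right 0. \<forall>k. x + t \<noteq> d * of_int k"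
proof -
  have "x < d * (of_int \<lfloor>x / d\<rfloor> + 1)"
    using assms by (metis floor_correct mult.commute of_int_1 of_int_add pos_divide_less_eq)
  then have "0 < d * (of_int \<lfloor>x / d\<rfloor> + 1) - x" by simp
  then have "\<forall>\<^sub>F t in at_right 0. t \<in> {0 <..< d * (of_int \<lfloor>x / d\<rfloor> + 1) - x}"
    by (rule eventually_at_right_real)
  then show ?thesis
  proof (rule eventually_mono, intro allI notI)
    fix t k assume t: "t \<in> {0 <..< d * (of_int \<lfloor>x / d\<rfloor> + 1) - x}" and k: "x + t = d * of_int k"
    have "d * of_int k < d * of_int (\<lfloor>x / d\<rfloor> + 1)" using t k by auto
    then have "k < \<lfloor>x / d\<rfloor> + 1" using assms by (simp add: mult_less_cancel_left_pos del: of_int_add)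
    moreover have "x / d < of_int k"
      using t k assms by (simp add: divide_less_eq mult.commute)
    then have "\<lfloor>x / d\<rfloor> < k" using floor_less_iff by blast
    ultimately show False by simp
  qed
qed

lemma ex_grid_square:
  assumes "d > 0"
  obtains i j where "z \<in> grid_square d (i, j)"
proof
  have *: "d * of_int \<lfloor>x / d\<rfloor> \<le> x" "x \<le> d * of_int (\<lfloor>x / d\<rfloor> + 1)" for x
    using of_int_floor_le[of "x / d"] real_of_int_floor_add_one_ge[of "x / d"]
    unfolding pos_le_divide_eq[OF assms] pos_divide_le_eq[OF assms] by (simp_all add: mult.commute)
  show "z \<in> grid_square d (\<lfloor>Re z / d\<rfloor>, \<lfloor>Im z / d\<rfloor>)"
    unfolding grid_square_iff using * by blast
qed

lemma grid_square_unique: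
  assumes "d > 0" "z \<in> grid_square d p" "z \<in> grid_square d q"
    "\<And>k. Re z \<noteq> d * of_int k" "\<And>k. Im z \<noteq> d * of_int k"
  shows "p = q"
proof -
  have *: "k = l" if "d * of_int k \<le> x" "x \<le> d * of_int (k + 1)" "d * of_int l \<le> x" "x \<le> d * of_int (l + 1)"
    "\<And>k. x \<noteq> d * of_int k" for k l x
  proof -
    have "d * of_int k < d * of_int (l + 1)" "d * of_int l < d * of_int (k + 1)"
      using that(1-4) that(5)[of "l + 1"] that(5)[of "k + 1"] by linarith+
    then have "k < l + 1" "l < k + 1"
      unfolding mult_less_cancel_left_pos[OF assms(1)] of_int_less_iff by auto
    then show ?thesis by simp
  qed
  show ?thesis
    using assms(2-) by (cases p, cases q) (simp only: grid_square_iff, blast intro: *)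
qed

text \<open>The Cauchy integrals over the boundaries of the grid squares that meet \<open>K\<close> add up to \<open>h\<close>;
  an edge shared by two such squares cancels, so only edges disjoint from \<open>K\<close> survive.\<close>

lemma Cauchy_formula_edges:
  assumes "compact K" "open U" "K \<subseteq> U" "h holomorphic_on U"
  obtains E :: "(complex \<times> complex) set" and c
  where "finite E" "\<And>a b. (a, b) \<in> E \<Longrightarrow> closed_segment a b \<subseteq> U - K"
    "\<And>z. z \<in> interior K \<Longrightarrow>
       h z = (\<Sum>(a, b)\<in>E. c (a, b) * contour_integral (linepath a b) (\<lambda>w. h w / (w - z)))"
proof -
  obtain e where e: "e > 0" "{x. infdist x K \<le> e} \<subseteq> U" if "K \<noteq> {}"
    using compact_in_open_separated[OF _ assms(1-3)] by metis
  \<comment> \<open>A square has diameter at most 2 * d, so mesh e / 2 keeps every square that meets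
    \<open>K\<close> within distance e of \<open>K\<close>, hence inside \<open>U\<close>.\<close>
  define d where "d = (if K = {} then 1 else e / 2)"
  have d: "d > 0" using e by (auto simp: d_def)
  define A where "A = {p. grid_square d p \<inter> K \<noteq> {}}"
  have finA: "finite A" unfolding A_def
    using finite_grid_squares_meeting compact_imp_bounded assms(1) d by blast
  have AU: "grid_square d p \<subseteq> U" if "p \<in> A" for p
  proof
    fix w assume w: "w \<in> grid_square d p"
    obtain x where x: "x \<in> K" "x \<in> grid_square d p" using \<open>p \<in> A\<close> unfolding A_def by blast
    then have "infdist w K \<le> dist w x" by (simp add: infdist_le)
    also have "d = e / 2" using x by (auto simp: d_def)
    then have "dist w x \<le> e" using grid_square_diameter[OF w x(2)] by simp
    finally show "w \<in> U" using e(2) x by auto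
  qed
  define \<sigma> where "\<sigma> = (\<lambda>p. if p \<in> A then 1 else 0 :: complex)"
  define up right down left where "up = (\<lambda>(i::int, j::int). (i, j + 1))"
    and "right = (\<lambda>(i::int, j::int). (i + 1, j))"
    and "down = (\<lambda>(i::int, j::int). (i, j - 1))"
    and "left = (\<lambda>(i::int, j::int). (i - 1, j))"
  \<comment> \<open>Bottom and left edges of a square p carry the index p, its top edge the index
    \<open>up p\<close> and its right edge the index \<open>right p\<close>; \<open>T\<close>
    collects all of them.\<close>
  define T where "T = A \<union> up ` A \<union> right ` A"
  have finT: "finite T" unfolding T_def using finA by auto
  have T: "A \<subseteq> T" "up ` A \<subseteq> T" "right ` A \<subseteq> T" by (auto simp: T_def)
  define he ve where "he = (\<lambda>(i, j). (grid_point d i j, grid_point d (i + 1) j))"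
    and "ve = (\<lambda>(i, j). (grid_point d i j, grid_point d i (j + 1)))"
  \<comment> \<open>The total multiplicity of an edge: the bottom edge of p is also the top edge of
    \<open>down p\<close>, and the left edge of p is also the right edge of \<open>left p\<close>.
    It is nonzero exactly if one of the two neighbours meets \<open>K\<close> and the other does
    not. The edge lies in both, so it misses \<open>K\<close>, and it lies in a square contained in
    \<open>U\<close>.\<close>
  define ch cv where "ch = (\<lambda>p. \<sigma> p - \<sigma> (down p))" and "cv = (\<lambda>p. \<sigma> (left p) - \<sigma> p)"
  define P where "P = {p \<in> T. ch p \<noteq> 0}"
  define Q where "Q = {p \<in> T. cv p \<noteq> 0}"
  have hseg: "closed_segment (fst (he p)) (snd (he p)) \<subseteq> U - K" if "p \<in> P" for p
  proof -
    obtain i j where p: "p = (i, j)" by (cases p)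
    have "closed_segment (fst (he p)) (snd (he p)) \<subseteq> grid_square d p \<inter> grid_square d (down p)"
      using horizontal_edge_subset_grid_square[OF d] by (simp add: he_def p down_def)
    moreover have "p \<in> A \<and> down p \<notin> A \<or> p \<notin> A \<and> down p \<in> A"
      using that by (auto simp: P_def ch_def \<sigma>_def split: if_splits)
    ultimately show ?thesis using AU unfolding A_def by blast
  qed
  have vseg: "closed_segment (fst (ve p)) (snd (ve p)) \<subseteq> U - K" if "p \<in> Q" for p
  proof -
    obtain i j where p: "p = (i, j)" by (cases p)
    have "closed_segment (fst (ve p)) (snd (ve p)) \<subseteq> grid_square d p \<inter> grid_square d (left p)"
      using vertical_edge_subset_grid_square[OF d] by (simp add: ve_def p left_def)
    moreover have "p \<in> A \<and> left p \<notin> A \<or> p \<notin> A \<and> left p \<in> A"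
      using that by (auto simp: Q_def cv_def \<sigma>_def split: if_splits)
    ultimately show ?thesis using AU unfolding A_def by blast
  qed
  define CI where "CI = (\<lambda>z e. contour_integral (linepath (fst e) (snd e)) (\<lambda>w. h w / (w - z)) / (2 * pi * \<i>))"
  define G where "G = (\<lambda>z. (\<Sum>p\<in>P. ch p * CI z (he p)) + (\<Sum>p\<in>Q. cv p * CI z (ve p)))"
  \<comment> \<open>Off the grid lines z lies on no edge, so all boundary integrals make sense
    separately and exactly one square contributes.\<close>
  have generic: "h z = G z"
    if z: "z \<in> K" "\<And>k. Re z \<noteq> d * of_int k" "\<And>k. Im z \<noteq> d * of_int k" for z
  proof -
    let ?g = "\<lambda>w. h w / (w - z)"
    let ?R = "\<lambda>p. rectpath (grid_point d (fst p) (snd p)) (grid_point d (fst p + 1) (snd p + 1))"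
    have R: "contour_integral (?R p) ?g / (2 * pi * \<i>)
       = CI z (he p) - CI z (he (up p)) + CI z (ve (right p)) - CI z (ve p)" if p: "p \<in> A" for p
    proof -
      obtain i j where ij: "p = (i, j)" by (cases p)
      have "path_image (?R p) \<subseteq> grid_square d p - {z}"
        unfolding ij grid_square_def
        using z(2)[of i] z(2)[of "i + 1"] z(3)[of j] z(3)[of "j + 1"] d
        by (auto simp: path_image_rectpath grid_point_def in_cbox_complex_iff)
      moreover have "continuous_on (grid_square d p - {z}) ?g"
        using holomorphic_on_imp_continuous_on[OF holomorphic_on_subset[OF assms(4) AU[OF p]]]
        by (intro continuous_intros) (auto elim: continuous_on_subset)
      ultimately have c: "continuous_on (path_image (?R p)) ?g" using continuous_on_subset by blast
      have "contour_integral (?R p) ?g =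
         contour_integral (linepath (fst (he p)) (snd (he p))) ?g
         - contour_integral (linepath (fst (he (up p))) (snd (he (up p)))) ?g
         + contour_integral (linepath (fst (ve (right p))) (snd (ve (right p)))) ?g
         - contour_integral (linepath (fst (ve p)) (snd (ve p))) ?g"
        using contour_integral_rectpath_edges[of "d * of_int i" "d * of_int j" "d * of_int (i + 1)"
            "d * of_int (j + 1)" ?g] c d
        by (simp add: ij grid_point_def he_def ve_def up_def right_def)
      then show ?thesis by (simp add: CI_def diff_divide_distrib add_divide_distrib)
    qed
    obtain p0 where p0: "z \<in> grid_square d p0" using ex_grid_square[OF d] by blast
    then have p0A: "p0 \<in> A" using z(1) by (auto simp: A_def)
    have val: "contour_integral (?R p) ?g = (if p = p0 then 2 * pi * \<i> * h z else 0)" if p: "p \<in> A" for p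
    proof -
      have "z \<in> grid_square d p \<longleftrightarrow> p = p0"
        using grid_square_unique[OF d _ p0 z(2,3)] p0 by blast
      moreover have "h holomorphic_on grid_square d (fst p, snd p)"
        using AU[OF p] assms(4) holomorphic_on_subset by auto
      ultimately show ?thesis
        using contour_integral_grid_square[OF d _ z(2,3), of h "fst p" "snd p"] by simp
    qed
    have "h z = (\<Sum>p\<in>A. if p = p0 then h z else 0)" using p0A finA by simp
    also have "\<dots> = (\<Sum>p\<in>A. contour_integral (?R p) ?g / (2 * pi * \<i>))"
      by (intro sum.cong) (auto simp: val)
    also have "\<dots> = (\<Sum>p\<in>A. CI z (he p) - CI z (he (up p)) + CI z (ve (right p)) - CI z (ve p))"
      by (intro sum.cong R refl)
    also have "\<dots> = (\<Sum>p\<in>T. \<sigma> p * (CI z (he p) - CI z (he (up p)) + CI z (ve (right p)) - CI z (ve p)))"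
      using finT T by (intro sum.mono_neutral_cong_left) (auto simp: \<sigma>_def)
    also have "\<dots> = ((\<Sum>p\<in>T. \<sigma> p * CI z (he p)) - (\<Sum>p\<in>T. \<sigma> p * CI z (he (up p))))
       + ((\<Sum>p\<in>T. \<sigma> p * CI z (ve (right p))) - (\<Sum>p\<in>T. \<sigma> p * CI z (ve p)))"
      by (simp add: sum.distrib sum_subtractf algebra_simps)
    \<comment> \<open>Top edges are renamed as bottom edges of the square above, and below right
      edges as left edges; this is where the cancellation takes place.\<close>
    also have "(\<Sum>p\<in>T. \<sigma> p * CI z (he (up p))) = (\<Sum>p\<in>T. \<sigma> (down p) * CI z (he p))"
      by (rule sum_shift_finite_support[OF finT T(1,2)]) (auto simp: \<sigma>_def up_def down_def)
    also have "(\<Sum>p\<in>T. \<sigma> p * CI z (ve (right p))) = (\<Sum>p\<in>T. \<sigma> (left p) * CI z (ve p))"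
      by (rule sum_shift_finite_support[OF finT T(1,3)]) (auto simp: \<sigma>_def right_def left_def)
    also have "(\<Sum>p\<in>T. \<sigma> p * CI z (he p)) - (\<Sum>p\<in>T. \<sigma> (down p) * CI z (he p)) = (\<Sum>p\<in>T. ch p * CI z (he p))"
      by (simp add: ch_def sum_subtractf algebra_simps)
    also have "\<dots> = (\<Sum>p\<in>P. ch p * CI z (he p))"
      using finT by (intro sum.mono_neutral_right) (auto simp: P_def)
    also have "(\<Sum>p\<in>T. \<sigma> (left p) * CI z (ve p)) - (\<Sum>p\<in>T. \<sigma> p * CI z (ve p)) = (\<Sum>p\<in>T. cv p * CI z (ve p))"
      by (simp add: cv_def sum_subtractf algebra_simps)
    also have "\<dots> = (\<Sum>p\<in>Q. cv p * CI z (ve p))"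
      using finT by (intro sum.mono_neutral_right) (auto simp: Q_def)
    finally show ?thesis by (simp add: G_def)
  qed
  have contCI: "continuous_on (interior K) (\<lambda>z. CI z e)" if "e = (a, b)" "closed_segment a b \<subseteq> U - K" for e a b
  proof -
    have "continuous_on (closed_segment a b) h"
      using that(2) assms(4) by (meson Diff_subset continuous_on_subset holomorphic_on_imp_continuous_on order_trans)
    moreover have "interior K \<inter> closed_segment a b = {}" using that(2) interior_subset by blast
    ultimately show ?thesis unfolding CI_def that(1)
      using continuous_on_contour_integral_Cauchy_kernel[of a b h "interior K"]
      by (auto intro!: continuous_intros)
  qed
  have contG: "continuous_on (interior K) G"
    unfolding G_def by (intro continuous_intros contCI[OF prod.collapse[symmetric]] hseg vseg)
  have all: "h z = G z" if z: "z \<in> interior K" for z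
  proof -
    \<comment> \<open>Along the diagonal, real and imaginary parts grow by the same t, so for small
      t > 0 the point is off every grid line. Both sides are continuous on the interior of
      \<open>K\<close>, and the identity passes to the limit z.\<close>
    let ?w = "\<lambda>t::real. z + of_real t * (1 + \<i>)"
    have lim: "(?w \<longlongrightarrow> z) (at_right 0)" by (auto intro!: tendsto_eq_intros)
    have "\<forall>\<^sub>F t in at_right 0. ?w t \<in> interior K"
      using lim z open_interior topological_tendstoD by blast
    moreover have "\<forall>\<^sub>F t in at_right 0. \<forall>k. Re (?w t) \<noteq> d * of_int k"
      using eventually_add_notin_multiples[OF d, of "Re z"] by simp
    moreover have "\<forall>\<^sub>F t in at_right 0. \<forall>k. Im (?w t) \<noteq> d * of_int k"
      using eventually_add_notin_multiples[OF d, of "Im z"] by simp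
    ultimately have ev: "\<forall>\<^sub>F t in at_right 0. h (?w t) = G (?w t)"
      by eventually_elim (use generic interior_subset in blast)
    have "continuous_on (interior K) h"
      using assms(3,4) by (meson continuous_on_subset holomorphic_on_imp_continuous_on interior_subset)
    then have "((\<lambda>t. h (?w t)) \<longlongrightarrow> h z) (at_right 0)"
      using lim z isCont_tendsto_compose[of z h ?w] continuous_on_interior[of "interior K" h]
      by (simp add: interior_open)
    then have "((\<lambda>t. G (?w t)) \<longlongrightarrow> h z) (at_right 0)"
      using tendsto_cong[OF ev] by blast
    moreover have "((\<lambda>t. G (?w t)) \<longlongrightarrow> G z) (at_right 0)"
      using contG lim z isCont_tendsto_compose[of z G ?w] continuous_on_interior[of "interior K" G]
      by (simp add: interior_open)
    ultimately show ?thesis by (rule tendsto_unique[OF trivial_limit_at_right_real])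
  qed
  \<comment> \<open>Coefficients are grouped by segment, so that \<open>E\<close> is a set of
    endpoint pairs; the factor 2 pi i of Cauchy's formula is absorbed here.\<close>
  define c where "c = (\<lambda>e. ((\<Sum>p | p \<in> P \<and> he p = e. ch p) + (\<Sum>p | p \<in> Q \<and> ve p = e. cv p)) / (2 * pi * \<i>))"
  define E where "E = he ` P \<union> ve ` Q"
  have finPQ: "finite P" "finite Q" using finT by (auto simp: P_def Q_def)
  show ?thesis
  proof
    show finE: "finite E" using finPQ by (auto simp: E_def)
    show "closed_segment a b \<subseteq> U - K" if "(a, b) \<in> E" for a b
    proof -
      obtain p where "p \<in> P \<and> (a, b) = he p \<or> p \<in> Q \<and> (a, b) = ve p"
        using \<open>(a, b) \<in> E\<close> unfolding E_def by blast
      then show ?thesis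
      proof (elim disjE conjE)
        assume "p \<in> P" "(a, b) = he p"
        then show ?thesis using hseg[of p] by (cases "he p") simp
      next
        assume "p \<in> Q" "(a, b) = ve p"
        then show ?thesis using vseg[of p] by (cases "ve p") simp
      qed
    qed
    fix z assume z: "z \<in> interior K"
    have "(\<Sum>e\<in>E. (\<Sum>p | p \<in> P \<and> he p = e. ch p) * CI z e) = (\<Sum>e\<in>E. (\<Sum>p | p \<in> P \<and> he p = e. ch p * CI z (he p)))"
      by (intro sum.cong) (auto simp: sum_distrib_right)
    also have "\<dots> = (\<Sum>p\<in>P. ch p * CI z (he p))"
      by (rule sum.group) (auto simp: finE finPQ E_def)
    finally have 1: "(\<Sum>e\<in>E. (\<Sum>p | p \<in> P \<and> he p = e. ch p) * CI z e) = (\<Sum>p\<in>P. ch p * CI z (he p))" .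
    have "(\<Sum>e\<in>E. (\<Sum>p | p \<in> Q \<and> ve p = e. cv p) * CI z e) = (\<Sum>e\<in>E. (\<Sum>p | p \<in> Q \<and> ve p = e. cv p * CI z (ve p)))"
      by (intro sum.cong) (auto simp: sum_distrib_right)
    also have "\<dots> = (\<Sum>p\<in>Q. cv p * CI z (ve p))"
      by (rule sum.group) (auto simp: finE finPQ E_def)
    finally have 2: "(\<Sum>e\<in>E. (\<Sum>p | p \<in> Q \<and> ve p = e. cv p) * CI z e) = (\<Sum>p\<in>Q. cv p * CI z (ve p))" .
    have "h z = (\<Sum>e\<in>E. (\<Sum>p | p \<in> P \<and> he p = e. ch p) * CI z e) + (\<Sum>e\<in>E. (\<Sum>p | p \<in> Q \<and> ve p = e. cv p) * CI z e)"
      using all[OF z] 1 2 by (simp add: G_def)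
    also have "\<dots> = (\<Sum>(a, b)\<in>E. c (a, b) * contour_integral (linepath a b) (\<lambda>w. h w / (w - z)))"
      unfolding sum.distrib[symmetric] by (intro sum.cong) (auto simp: c_def CI_def field_simps)
    finally show "h z = (\<Sum>(a, b)\<in>E. c (a, b) * contour_integral (linepath a b) (\<lambda>w. h w / (w - z)))" .
  qed
qed

section \<open>Runge's theorem for polynomials\<close>

definition uniform_poly_limits :: "complex set \<Rightarrow> (complex \<Rightarrow> complex) set" where
  "uniform_poly_limits L = {g. \<forall>\<epsilon>>0. \<exists>p. \<forall>z\<in>L. norm (g z - poly p z) < \<epsilon>}"

lemma uniform_poly_limitsD:
  assumes "g \<in> uniform_poly_limits L" "\<epsilon> > 0"
  obtains p where "\<And>z. z \<in> L \<Longrightarrow> norm (g z - poly p z) < \<epsilon>"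
  using assms unfolding uniform_poly_limits_def by blast

lemma poly_uniform_poly_limits: "poly p \<in> uniform_poly_limits L"
  by (auto simp: uniform_poly_limits_def intro!: exI[of _ p])

lemma const_uniform_poly_limits: "(\<lambda>z. c) \<in> uniform_poly_limits L"
  by (auto simp: uniform_poly_limits_def intro!: exI[of _ "[:c:]"])

lemma ident_uniform_poly_limits: "(\<lambda>z. z) \<in> uniform_poly_limits L"
  by (auto simp: uniform_poly_limits_def intro!: exI[of _ "[:0, 1:]"])

lemma uniform_poly_limits_closed:
  assumes "\<And>\<epsilon>. \<epsilon> > 0 \<Longrightarrow> \<exists>h\<in>uniform_poly_limits L. \<forall>z\<in>L. norm (g z - h z) < \<epsilon>"
  shows "g \<in> uniform_poly_limits L"
  unfolding uniform_poly_limits_def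
proof clarify
  fix \<epsilon> :: real assume "\<epsilon> > 0"
  then have e: "\<epsilon> / 2 > 0" by simp
  obtain h where h: "h \<in> uniform_poly_limits L" "\<And>z. z \<in> L \<Longrightarrow> norm (g z - h z) < \<epsilon> / 2"
    using assms[OF e] by blast
  obtain p where p: "\<And>z. z \<in> L \<Longrightarrow> norm (h z - poly p z) < \<epsilon> / 2"
    using uniform_poly_limitsD[OF h(1) e] by blast
  show "\<exists>p. \<forall>z\<in>L. norm (g z - poly p z) < \<epsilon>"
    using h(2) p by (intro exI[of _ p] ballI norm_diff_triangle_less[of _ "h _" "\<epsilon> / 2" _ "\<epsilon> / 2", simplified]) auto
qed

lemma uniform_poly_limits_cong:
  assumes "g \<in> uniform_poly_limits L" "\<And>z. z \<in> L \<Longrightarrow> h z = g z"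
  shows "h \<in> uniform_poly_limits L"
  using assms by (auto simp: uniform_poly_limits_def)

lemma add_uniform_poly_limits:
  assumes "f \<in> uniform_poly_limits L" "g \<in> uniform_poly_limits L"
  shows "(\<lambda>z. f z + g z) \<in> uniform_poly_limits L"
  unfolding uniform_poly_limits_def
proof clarify
  fix \<epsilon> :: real assume "\<epsilon> > 0"
  then have e: "\<epsilon> / 2 > 0" by simp
  obtain p q where "\<And>z. z \<in> L \<Longrightarrow> norm (f z - poly p z) < \<epsilon> / 2" "\<And>z. z \<in> L \<Longrightarrow> norm (g z - poly q z) < \<epsilon> / 2"
    using uniform_poly_limitsD[OF assms(1) e] uniform_poly_limitsD[OF assms(2) e] by metis
  then have "norm ((f z + g z) - poly (p + q) z) < \<epsilon>" if "z \<in> L" for z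
    using that norm_add_less[of "f z - poly p z" "\<epsilon> / 2" "g z - poly q z" "\<epsilon> / 2"] by (simp add: algebra_simps)
  then show "\<exists>p. \<forall>z\<in>L. norm (f z + g z - poly p z) < \<epsilon>" by blast
qed

lemma mult_uniform_poly_limits:
  assumes "bounded L" "f \<in> uniform_poly_limits L" "g \<in> uniform_poly_limits L"
  shows "(\<lambda>z. f z * g z) \<in> uniform_poly_limits L"
proof -
  have bdd_poly: "\<exists>B. \<forall>z\<in>L. norm (poly p z) \<le> B" for p
  proof -
    have "bounded (poly p ` closure L)"
      using assms(1) by (intro compact_imp_bounded compact_continuous_image continuous_intros) auto
    then show ?thesis using closure_subset unfolding bounded_iff by blast
  qed
  have bdd: "\<exists>B>0. \<forall>z\<in>L. norm (h z) \<le> B" if "h \<in> uniform_poly_limits L" for h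
  proof -
    have "0 < (1 :: real)" by simp
    then obtain p where p: "\<And>z. z \<in> L \<Longrightarrow> norm (h z - poly p z) < 1"
      using uniform_poly_limitsD[OF \<open>h \<in> _\<close>] by blast
    obtain B where B: "\<And>z. z \<in> L \<Longrightarrow> norm (poly p z) \<le> B" using bdd_poly by metis
    have "norm (h z) \<le> \<bar>B\<bar> + 1" if "z \<in> L" for z
      using p[OF that] B[OF that] norm_triangle_sub[of "h z" "poly p z"] by linarith
    then show ?thesis by (intro exI[of _ "\<bar>B\<bar> + 1"]) auto
  qed
  obtain B where B: "B > 0" "\<And>z. z \<in> L \<Longrightarrow> norm (g z) \<le> B" using bdd[OF assms(3)] by metis
  show ?thesis
    unfolding uniform_poly_limits_def
  proof clarify
    fix \<epsilon> :: real assume e: "\<epsilon> > 0"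
    obtain p where p: "\<And>z. z \<in> L \<Longrightarrow> norm (f z - poly p z) < \<epsilon> / (2 * B)"
      using uniform_poly_limitsD[OF assms(2), of "\<epsilon> / (2 * B)"] e B(1) by auto
    \<comment> \<open>\<open>q\<close> is chosen after \<open>p\<close>, because the accuracy
      required of it depends on the bound \<open>C\<close> for the already chosen
      \<open>p\<close>.\<close>
    obtain C where C: "C > 0" "\<And>z. z \<in> L \<Longrightarrow> norm (poly p z) \<le> C"
      using bdd[OF poly_uniform_poly_limits] by metis
    obtain q where q: "\<And>z. z \<in> L \<Longrightarrow> norm (g z - poly q z) < \<epsilon> / (2 * C)"
      using uniform_poly_limitsD[OF assms(3), of "\<epsilon> / (2 * C)"] e C(1) by auto
    have "norm (f z * g z - poly (p * q) z) < \<epsilon>" if z: "z \<in> L" for z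
    proof -
      have "f z * g z - poly (p * q) z = (f z - poly p z) * g z + poly p z * (g z - poly q z)"
        by (simp add: algebra_simps)
      also have "norm \<dots> \<le> norm (f z - poly p z) * norm (g z) + norm (poly p z) * norm (g z - poly q z)"
        by (metis norm_mult norm_triangle_ineq)
      also have "\<dots> \<le> norm (f z - poly p z) * B + C * norm (g z - poly q z)"
        by (intro add_mono mult_mono B C z) (use B C in auto)
      also have "\<dots> < \<epsilon> / (2 * B) * B + C * (\<epsilon> / (2 * C))"
        by (intro add_strict_mono mult_strict_right_mono mult_strict_left_mono p q z B C)
      also have "\<dots> = \<epsilon>" using B C by simp
      finally show ?thesis .
    qed
    then show "\<exists>p. \<forall>z\<in>L. norm (f z * g z - poly p z) < \<epsilon>" by blast
  qed
qed

lemma sum_uniform_poly_limits: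
  assumes "\<And>i. i \<in> I \<Longrightarrow> f i \<in> uniform_poly_limits L"
  shows "(\<lambda>z. \<Sum>i\<in>I. f i z) \<in> uniform_poly_limits L"
  using assms by (induction I rule: infinite_finite_induct)
    (auto intro: const_uniform_poly_limits add_uniform_poly_limits)

text \<open>The partial geometric sums have remainder r^N / (1 - r), of modulus at most 2 * (1/2)^N.
  This is how poles enter the algebra, and the ratio 1/2 determines the distances in
  \<open>pole_pushing\<close>.\<close>

lemma geometric_uniform_poly_limits:
  assumes "bounded L" "r \<in> uniform_poly_limits L" "\<And>z. z \<in> L \<Longrightarrow> norm (r z) \<le> 1 / 2"
  shows "(\<lambda>z. 1 / (1 - r z)) \<in> uniform_poly_limits L"
proof (rule uniform_poly_limits_closed)
  fix \<epsilon> :: real assume "\<epsilon> > 0"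
  then obtain N where N: "(1 / 2) ^ N < \<epsilon> / 2" using real_arch_pow_inv[of "\<epsilon> / 2" "1 / 2"] by auto
  have pow: "(\<lambda>z. r z ^ n) \<in> uniform_poly_limits L" for n
    by (induction n) (auto intro: const_uniform_poly_limits mult_uniform_poly_limits assms)
  have "norm (1 / (1 - r z) - (\<Sum>n<N. r z ^ n)) < \<epsilon>" if z: "z \<in> L" for z
  proof -
    have ne: "r z \<noteq> 1" using assms(3)[OF z] by auto
    have ge: "norm (1 - r z) \<ge> 1 / 2" using assms(3)[OF z] norm_triangle_ineq2[of 1 "r z"] by simp
    have "1 / (1 - r z) - (\<Sum>n<N. r z ^ n) = r z ^ N / (1 - r z)"
      using ne by (simp add: geometric_sum field_simps)
    also have "norm \<dots> \<le> (1 / 2) ^ N / (1 / 2)"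
      unfolding norm_divide norm_power using ge assms(3)[OF z]
      by (intro frac_le power_mono) auto
    also have "\<dots> < \<epsilon>" using N by simp
    finally show ?thesis .
  qed
  then show "\<exists>h\<in>uniform_poly_limits L. \<forall>z\<in>L. norm (1 / (1 - r z) - h z) < \<epsilon>"
    by (intro bexI[of _ "\<lambda>z. \<Sum>n<N. r z ^ n"] sum_uniform_poly_limits pow) auto
qed

text \<open>A pole at \<open>w0\<close>, at least twice as far from 0 as all of \<open>L\<close>, is
  handled by expanding in z / w0. From there the pole travels through the connected set
  \<open>T\<close> in steps of at most half the distance from \<open>T\<close> to \<open>L\<close>;
  compactness of \<open>T\<close> makes this distance positive.\<close>

lemma pole_pushing:
  assumes "compact L" "compact T" "connected T" "T \<inter> L = {}" "w \<in> T"
    "w0 \<in> T" "w0 \<noteq> 0" "\<And>z. z \<in> L \<Longrightarrow> norm z \<le> norm w0 / 2"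
  shows "(\<lambda>z. 1 / (w - z)) \<in> uniform_poly_limits L"
proof -
  let ?P = "\<lambda>w. (\<lambda>z. 1 / (w - z)) \<in> uniform_poly_limits L"
  have bL: "bounded L" using assms(1) compact_imp_bounded by blast
  have P0: "?P w0"
  proof -
    have "(\<lambda>z. 1 / w0 * z) \<in> uniform_poly_limits L"
      by (intro mult_uniform_poly_limits bL const_uniform_poly_limits ident_uniform_poly_limits)
    moreover have "norm (1 / w0 * z) \<le> 1 / 2" if "z \<in> L" for z
      using assms(7) assms(8)[OF that] by (simp add: norm_divide field_simps)
    ultimately have "(\<lambda>z. 1 / (1 - 1 / w0 * z)) \<in> uniform_poly_limits L"
      by (intro geometric_uniform_poly_limits bL)
    then have "(\<lambda>z. 1 / w0 * (1 / (1 - 1 / w0 * z))) \<in> uniform_poly_limits L"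
      by (intro mult_uniform_poly_limits bL const_uniform_poly_limits)
    then show ?thesis
      by (rule uniform_poly_limits_cong) (use assms(7) in \<open>simp add: right_diff_distrib\<close>)
  qed
  obtain d where d: "d > 0" "\<And>x y. x \<in> T \<Longrightarrow> y \<in> L \<Longrightarrow> d \<le> dist x y"
    using separate_compact_closed[OF assms(2) compact_imp_closed[OF assms(1)] assms(4)] by blast
  \<comment> \<open>The step is the identity 1 / (v - z) = 1 / (u - z) * 1 / (1 - (u - v) / (u -
    z)), whose ratio has modulus at most 1/2.\<close>
  have step: "?P v" if u: "?P u" "u \<in> T" "v \<in> T" "dist u v \<le> d / 2" for u v
  proof -
    have "(\<lambda>z. (u - v) * (1 / (u - z))) \<in> uniform_poly_limits L"
      by (intro mult_uniform_poly_limits bL const_uniform_poly_limits u(1))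
    moreover have "norm ((u - v) * (1 / (u - z))) \<le> 1 / 2" if "z \<in> L" for z
    proof -
      have "2 * norm (u - v) \<le> norm (u - z)" "norm (u - z) > 0"
        using d(2)[OF u(2) that] u(4) d(1) by (auto simp: dist_norm)
      then show ?thesis by (simp add: norm_divide norm_mult pos_divide_le_eq)
    qed
    ultimately have "(\<lambda>z. 1 / (1 - (u - v) * (1 / (u - z)))) \<in> uniform_poly_limits L"
      by (intro geometric_uniform_poly_limits bL)
    then have "(\<lambda>z. 1 / (u - z) * (1 / (1 - (u - v) * (1 / (u - z))))) \<in> uniform_poly_limits L"
      by (intro mult_uniform_poly_limits bL u(1))
    then show ?thesis
    proof (rule uniform_poly_limits_cong)
      fix z assume z: "z \<in> L"
      then have "u \<noteq> z" "v \<noteq> z" using u assms(4) by auto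
      then show "1 / (v - z) = 1 / (u - z) * (1 / (1 - (u - v) * (1 / (u - z))))"
        by (simp add: field_simps)
    qed
  qed
  show ?thesis
  proof (rule connected_induction_simple[OF assms(3) assms(6,5), of ?P])
    fix a assume a: "a \<in> T"
    \<comment> \<open>Radius d / 4 makes any two points of the ball at most d / 2 apart, which is
      one admissible step.\<close>
    have "openin (top_of_set T) (T \<inter> ball a (d / 4))" by (simp add: openin_open_Int)
    moreover have "\<forall>x\<in>T \<inter> ball a (d / 4). \<forall>y\<in>T \<inter> ball a (d / 4). ?P x \<longrightarrow> ?P y"
    proof clarify
      fix x y assume "x \<in> T" "y \<in> T" "x \<in> ball a (d / 4)" "y \<in> ball a (d / 4)" "?P x"
      moreover from this have "dist x y \<le> d / 2"
        using dist_triangle3[of x y a] by simp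
      ultimately show "?P y" using step by blast
    qed
    ultimately show "\<exists>S. openin (top_of_set T) S \<and> a \<in> S \<and> (\<forall>x\<in>S. \<forall>y\<in>S. ?P x \<longrightarrow> ?P y)"
      using a d(1) by (intro exI[of _ "T \<inter> ball a (d / 4)"]) auto
  qed (rule P0)
qed

section \<open>Riemann sums of Cauchy integrals\<close>

lemma integral_equipartition:
  fixes f :: "real \<Rightarrow> complex" and n :: nat
  assumes "continuous_on {0..1} f" "n > 0"
    "\<And>s t. s \<in> {0..1} \<Longrightarrow> t \<in> {0..1} \<Longrightarrow> \<bar>s - t\<bar> \<le> 1 / n \<Longrightarrow> norm (f s - f t) \<le> \<epsilon>"
  shows "norm (integral {0..1} f - (\<Sum>k<n. f (real k / n) * of_real (1 / n))) \<le> \<epsilon>"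
proof -
  have part: "norm (integral {0..m / n} f - (\<Sum>k<m. f (real k / n) * of_real (1 / n))) \<le> m * (\<epsilon> / n)"
    if "m \<le> n" for m
    using that
  proof (induction m)
    case 0
    show ?case by simp
  next
    case (Suc m)
    have le: "real m / n \<le> Suc m / n" "real (Suc m) / n \<le> 1" "0 \<le> real m / n"
      using Suc.prems assms(2) by (simp_all add: divide_right_mono)
    have cont: "continuous_on {real m / n..Suc m / n} f" "continuous_on {0..Suc m / n} f"
      using continuous_on_subset[OF assms(1), of "{real m / n..Suc m / n}"]
        continuous_on_subset[OF assms(1), of "{0..Suc m / n}"] le by simp_all
    have comb: "integral {0..m / n} f + integral {m / n..Suc m / n} f = integral {0..Suc m / n} f"
      by (rule Henstock_Kurzweil_Integration.integral_combine[OF le(3,1) integrable_continuous_interval[OF cont(2)]])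
    have "integral {m / n..Suc m / n} (\<lambda>t. f t - f (m / n))
        = integral {m / n..Suc m / n} f - f (m / n) * of_real (1 / n)"
    proof -
      have "Suc m / n - m / n = 1 / n" by (simp add: diff_divide_distrib[symmetric])
      then have "integral {m / n..Suc m / n} (\<lambda>t. f (m / n)) = f (m / n) * of_real (1 / n)"
        using le(1) by (simp add: scaleR_conv_of_real)
      then show ?thesis
        by (simp only: integral_diff[OF integrable_continuous_interval[OF cont(1)] integrable_const_ivl])
    qed
    moreover have "norm (integral {m / n..Suc m / n} (\<lambda>t. f t - f (m / n))) \<le> \<epsilon> * (Suc m / n - m / n)"
    proof (rule integral_bound[OF le(1)])
      show "continuous_on {real m / n..Suc m / n} (\<lambda>t. f t - f (m / n))"
        by (intro continuous_intros cont)
      fix t assume t: "t \<in> {real m / n..Suc m / n}"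
      have "real (Suc m) / n = m / n + 1 / n" by (simp add: add_divide_distrib)
      then have "\<bar>t - m / n\<bar> \<le> 1 / n" using t by auto
      moreover have "t \<in> {0..1}" "m / n \<in> {0..1}" using t le unfolding atLeastAtMost_iff by linarith+
      ultimately show "norm (f t - f (m / n)) \<le> \<epsilon>" by (intro assms(3))
    qed
    moreover have "\<epsilon> * (Suc m / n - m / n) = \<epsilon> / n" by (simp add: diff_divide_distrib[symmetric])
    moreover have "integral {m / n..Suc m / n} f = integral {0..Suc m / n} f - integral {0..m / n} f"
      using comb by (simp add: eq_diff_eq add.commute)
    ultimately have 1: "norm ((integral {0..Suc m / n} f - integral {0..m / n} f) - f (m / n) * of_real (1 / n)) \<le> \<epsilon> / n"
      by (simp only:)
    have "integral {0..Suc m / n} f - (\<Sum>k<Suc m. f (real k / n) * of_real (1 / n))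
       = (integral {0..m / n} f - (\<Sum>k<m. f (real k / n) * of_real (1 / n)))
        + ((integral {0..Suc m / n} f - integral {0..m / n} f) - f (m / n) * of_real (1 / n))"
      by simp
    also have "norm \<dots> \<le> m * (\<epsilon> / n) + \<epsilon> / n"
      using 1 Suc by (intro norm_triangle_mono) auto
    also have "\<dots> = Suc m * (\<epsilon> / n)" by (simp only: of_nat_Suc distrib_right mult_1)
    finally show ?case .
  qed
  show ?thesis using part[of n] assms(2) by simp
qed

text \<open>A Riemann sum of the integral is a linear combination of kernels 1 / (w - z) with w on
  the segment. Its error is uniform in z because the integrand is uniformly continuous on the
  compact product of [0, 1] and \<open>L\<close>.\<close>

lemma Cauchy_integral_uniform_poly_limits:
  assumes "compact L" "continuous_on (closed_segment a b) f" "closed_segment a b \<inter> L = {}"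
    "\<And>w. w \<in> closed_segment a b \<Longrightarrow> (\<lambda>z. 1 / (w - z)) \<in> uniform_poly_limits L"
  shows "(\<lambda>z. contour_integral (linepath a b) (\<lambda>w. f w / (w - z))) \<in> uniform_poly_limits L"
proof (rule uniform_poly_limits_closed)
  fix \<epsilon> :: real assume e: "\<epsilon> > 0"
  define \<phi> where "\<phi> = (\<lambda>(t, z). f (linepath a b t) * (b - a) * (1 / (linepath a b t - z)))"
  have seg: "linepath a b t \<in> closed_segment a b" if "t \<in> {0..1}" for t
    using that by (metis imageI linepath_image_01)
  have lp: "continuous_on ({0..1} \<times> L) (\<lambda>x. linepath a b (fst x))"
    unfolding linepath_def by (intro continuous_intros)
  have cont: "continuous_on ({0..1} \<times> L) \<phi>"
    unfolding \<phi>_def case_prod_unfold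
  proof (intro continuous_intros lp continuous_on_compose2[OF assms(2) lp] ballI)
    show "(\<lambda>x. linepath a b (fst x)) ` ({0..1} \<times> L) \<subseteq> closed_segment a b" using seg by auto
    show "linepath a b (fst x) - snd x \<noteq> 0" if "x \<in> {0..1} \<times> L" for x
      using that seg[of "fst x"] assms(3) by auto
  qed
  have "uniformly_continuous_on ({0..1} \<times> L) \<phi>"
    by (intro compact_uniformly_continuous cont compact_Times assms(1)) auto
  then obtain d where d: "d > 0"
    "\<And>x y. x \<in> {0..1} \<times> L \<Longrightarrow> y \<in> {0..1} \<times> L \<Longrightarrow> dist y x < d \<Longrightarrow> dist (\<phi> y) (\<phi> x) < \<epsilon> / 2"
    unfolding uniformly_continuous_on_def using e by (metis half_gt_zero)
  obtain n :: nat where n: "n > 0" "1 / n < d"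
    using d(1) real_arch_invD[of d] by (auto simp: inverse_eq_divide)
  have "norm (contour_integral (linepath a b) (\<lambda>w. f w / (w - z)) - (\<Sum>k<n. \<phi> (real k / n, z) * of_real (1 / n))) < \<epsilon>"
    if z: "z \<in> L" for z
  proof -
    have "contour_integral (linepath a b) (\<lambda>w. f w / (w - z)) = integral {0..1} (\<lambda>t. \<phi> (t, z))"
      unfolding contour_integral_integral \<phi>_def
      by (intro integral_cong) (auto simp: vector_derivative_linepath_within)
    moreover have "norm (integral {0..1} (\<lambda>t. \<phi> (t, z)) - (\<Sum>k<n. \<phi> (real k / n, z) * of_real (1 / n))) \<le> \<epsilon> / 2"
    proof (rule integral_equipartition[OF _ n(1)])
      show "continuous_on {0..1} (\<lambda>t. \<phi> (t, z))"
        using z by (intro continuous_on_compose2[OF cont] continuous_intros) auto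
      fix s t :: real assume "s \<in> {0..1}" "t \<in> {0..1}" "\<bar>s - t\<bar> \<le> 1 / n"
      then have "dist (\<phi> (s, z)) (\<phi> (t, z)) < \<epsilon> / 2"
        using z n by (intro d(2)) (auto simp: dist_Pair_Pair dist_real_def)
      then show "norm (\<phi> (s, z) - \<phi> (t, z)) \<le> \<epsilon> / 2" by (simp add: dist_norm)
    qed
    ultimately show ?thesis using e by simp
  qed
  moreover have "(\<lambda>z. \<Sum>k<n. \<phi> (real k / n, z) * of_real (1 / n)) \<in> uniform_poly_limits L"
    unfolding \<phi>_def case_prod_conv
  proof (rule sum_uniform_poly_limits)
    fix k assume "k \<in> {..<n}"
    then have "real k / n \<in> {0..1}" using n(1) by simp
    then have "(\<lambda>z. 1 / (linepath a b (real k / n) - z)) \<in> uniform_poly_limits L"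
      using assms(4) seg by blast
    then show "(\<lambda>z. f (linepath a b (real k / n)) * (b - a) * (1 / (linepath a b (real k / n) - z))
        * of_real (1 / n)) \<in> uniform_poly_limits L"
      using compact_imp_bounded[OF assms(1)]
      by (intro mult_uniform_poly_limits[OF _ mult_uniform_poly_limits] const_uniform_poly_limits)
  qed
  ultimately show "\<exists>h\<in>uniform_poly_limits L.
      \<forall>z\<in>L. norm (contour_integral (linepath a b) (\<lambda>w. f w / (w - z)) - h z) < \<epsilon>"
    by (intro bexI[where x = "\<lambda>z. \<Sum>k<n. \<phi> (real k / real n, z) * of_real (1 / n)"] ballI)
qed

text \<open>The approximation is claimed on a whole neighbourhood of \<open>K\<close>, so that
  Cauchy's estimates can turn it into approximation of all derivatives on \<open>K\<close>.\<close>

theorem Runge_polynomial: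
  assumes "compact K" "K \<noteq> {}" "connected (- K)" "open U" "K \<subseteq> U" "h holomorphic_on U"
  obtains \<delta> where "\<delta> > 0" "{z. infdist z K \<le> \<delta>} \<subseteq> U"
    "h \<in> uniform_poly_limits {z. infdist z K \<le> \<delta>}"
proof -
  obtain e where e: "e > 0" "{x. infdist x K \<le> e} \<subseteq> U"
    using compact_in_open_separated[OF assms(2,1,4,5)] by metis
  \<comment> \<open>The grid formula holds only in the interior of the set it surrounds; applied to
    this larger set, it holds on a neighbourhood of \<open>K\<close>.\<close>
  define K1 where "K1 = {x. infdist x K \<le> e}"
  have K1: "compact K1" "K \<subseteq> K1" "K1 \<subseteq> U"
    using e assms(1,2) by (auto simp: K1_def compact_infdist_le)
  obtain E c where E: "finite E" "\<And>a b. (a, b) \<in> E \<Longrightarrow> closed_segment a b \<subseteq> U - K1"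
    "\<And>z. z \<in> interior K1 \<Longrightarrow>
       h z = (\<Sum>(a, b)\<in>E. c (a, b) * contour_integral (linepath a b) (\<lambda>w. h w / (w - z)))"
    using Cauchy_formula_edges[OF K1(1) assms(4) K1(3) assms(6)] by blast
  obtain M where M: "M > 0" "\<And>z. z \<in> K1 \<Longrightarrow> norm z \<le> M"
    using compact_imp_bounded[OF K1(1)] bounded_pos by metis
  \<comment> \<open>Any point of modulus 2 * M serves: it lies outside \<open>K1\<close>, and half
    its modulus bounds all of \<open>K1\<close>, as \<open>pole_pushing\<close> demands.\<close>
  define w0 :: complex where "w0 = of_real (2 * M)"
  have w0: "w0 \<noteq> 0" "norm w0 / 2 = M" using M(1) by (auto simp: w0_def)
  have "w0 \<notin> K1" using M(2)[of w0] w0 M(1) by auto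
  then have w0K: "w0 \<in> - K" using K1 by auto
  have "path_connected (- K)"
    using assms(1,3) by (simp add: connected_open_path_connected compact_imp_closed open_Compl)
  then have "\<exists>g. path g \<and> path_image g \<subseteq> - K \<and> pathstart g = fst ab \<and> pathfinish g = w0" if "ab \<in> E" for ab
  proof -
    have "fst ab \<in> closed_segment (fst ab) (snd ab)" by simp
    then have "fst ab \<in> - K" using E(2)[of "fst ab" "snd ab"] that K1(2) by (metis ComplI Diff_iff in_mono prod.collapse)
    then show ?thesis using \<open>path_connected (- K)\<close> w0K unfolding path_connected_def by blast
  qed
  then obtain g where g: "\<And>ab. ab \<in> E \<Longrightarrow> path (g ab) \<and> path_image (g ab) \<subseteq> - K
      \<and> pathstart (g ab) = fst ab \<and> pathfinish (g ab) = w0" by metis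
  \<comment> \<open>Each edge is joined to \<open>w0\<close> by a path that avoids \<open>K\<close>;
    these pieces share \<open>w0\<close>, so their union \<open>T\<close> is connected and compact.
    The paths exist because the complement of \<open>K\<close> is open and connected. They may enter
    \<open>K1\<close>, so the final radius is chosen only after them.\<close>
  define V where "V = (\<lambda>ab. closed_segment (fst ab) (snd ab) \<union> path_image (g ab))"
  define T where "T = (\<Union>ab\<in>E. V ab) \<union> {w0}"
  have "compact T" unfolding T_def V_def
    using E(1) g by (intro compact_Un compact_UN) (auto simp: compact_path_image)
  have V: "connected (V ab)" "w0 \<in> V ab" "V ab \<subseteq> - K" if "ab \<in> E" for ab
  proof -
    have p: "path (g ab)" "pathstart (g ab) = fst ab" "pathfinish (g ab) = w0" using g that by auto
    have "fst ab \<in> closed_segment (fst ab) (snd ab) \<inter> path_image (g ab)"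
      using p pathstart_in_path_image[of "g ab"] by auto
    then show "connected (V ab)" unfolding V_def
      using p by (intro connected_Un connected_path_image) auto
    show "w0 \<in> V ab" using p pathfinish_in_path_image[of "g ab"] by (auto simp: V_def)
    show "V ab \<subseteq> - K" using g[OF that] E(2)[of "fst ab" "snd ab"] that K1(2) by (auto simp: V_def)
  qed
  have "connected T"
  proof -
    have "connected (\<Union>(insert {w0} (V ` E)))"
      using V by (intro connected_Union) auto
    moreover have "\<Union>(insert {w0} (V ` E)) = T" by (auto simp: T_def)
    ultimately show ?thesis by simp
  qed
  have "K \<subseteq> - T" using V(3) w0K by (auto simp: T_def)
  then obtain e' where e': "e' > 0" "{x. infdist x K \<le> e'} \<subseteq> - T"
    using compact_in_open_separated[OF assms(2,1) _, of "- T"] \<open>compact T\<close>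
    by (metis compact_imp_closed open_Compl)
  \<comment> \<open>The bound e / 2 puts \<open>L\<close> into the interior of \<open>K1\<close>,
    where the Cauchy formula holds; the bound e' keeps \<open>L\<close> away from the paths in
    \<open>T\<close>.\<close>
  define \<delta> where "\<delta> = min (e / 2) e'"
  define L where "L = {z. infdist z K \<le> \<delta>}"
  have \<delta>: "\<delta> > 0" "\<delta> \<le> e'" "\<delta> < e" using e e' by (auto simp: \<delta>_def)
  have L: "compact L" unfolding L_def using \<delta> assms(1,2) by (intro compact_infdist_le) auto
  have "open {z. infdist z K < e}"
    by (intro open_Collect_less continuous_intros)
  then have LK: "L \<subseteq> interior K1"
    using \<delta> by (intro interior_maximal[THEN subset_trans[rotated]]) (auto simp: L_def K1_def)
  have "L \<subseteq> {x. infdist x K \<le> e'}" using \<delta>(2) by (auto simp: L_def)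
  then have TL: "T \<inter> L = {}" using e'(2) by blast
  have pole: "(\<lambda>z. 1 / (w - z)) \<in> uniform_poly_limits L" if "w \<in> T" for w
  proof (rule pole_pushing[OF L \<open>compact T\<close> \<open>connected T\<close> TL that])
    show "w0 \<in> T" by (auto simp: T_def)
    show "norm z \<le> norm w0 / 2" if "z \<in> L" for z using M(2) LK w0(2) that interior_subset by blast
  qed (rule w0)
  have "(\<lambda>z. \<Sum>ab\<in>E. c ab * contour_integral (linepath (fst ab) (snd ab)) (\<lambda>w. h w / (w - z))) \<in> uniform_poly_limits L"
  proof (intro sum_uniform_poly_limits mult_uniform_poly_limits const_uniform_poly_limits
      Cauchy_integral_uniform_poly_limits compact_imp_bounded L)
    fix ab assume ab: "ab \<in> E"
    then have sub: "closed_segment (fst ab) (snd ab) \<subseteq> U" "closed_segment (fst ab) (snd ab) \<subseteq> T"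
      using E(2)[of "fst ab" "snd ab"] by (auto simp: T_def V_def)
    show "continuous_on (closed_segment (fst ab) (snd ab)) h"
      using sub assms(6) by (meson continuous_on_subset holomorphic_on_imp_continuous_on)
    show "closed_segment (fst ab) (snd ab) \<inter> L = {}" using sub TL by blast
    show "(\<lambda>z. 1 / (w - z)) \<in> uniform_poly_limits L" if "w \<in> closed_segment (fst ab) (snd ab)" for w
      using that sub pole by blast
  qed
  then have "h \<in> uniform_poly_limits L"
    by (rule uniform_poly_limits_cong) (use E(3) LK in \<open>auto simp: case_prod_unfold\<close>)
  then show ?thesis
    using that[of \<delta>] \<delta>(1) LK K1(3) interior_subset[of K1] by (auto simp: L_def)
qed

text \<open>A bounded clopen part of the complement of \<open>C \<inter> cball 0 r\<close> inside the ball would be clopen in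
  the complement of \<open>C\<close> on the sphere without containing \<open>\<infinity>\<close>.\<close>

lemma connected_Compl_Int_cball:
  fixes C :: "complex set"
  assumes "closed C"
    and con: "connectedin (Alexandroff_compactification (euclidean :: complex topology))
      (topspace (Alexandroff_compactification (euclidean :: complex topology)) - Some ` C)"
  shows "connected (- (C \<inter> cball 0 r))"
proof -
  let ?X = "Alexandroff_compactification (euclidean :: complex topology)"
  define Y where "Y = topspace ?X - Some ` C"
  define S where "S = - (C \<inter> cball 0 r)"
  have opS: "open S" unfolding S_def using assms(1) by (intro open_Compl closed_Int) auto
  have outer: "connected (- cball (0::complex) r)"
    by (rule connected_complement_bounded_convex) auto
  have empty: "T = {}"
    if T: "openin (top_of_set S) T" "closedin (top_of_set S) T" "T \<inter> - cball 0 r = {}" for T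
  proof -
    have opT: "open T" using T(1) opS openin_open_trans by blast
    have cl: "closure T \<inter> S = T"
    proof -
      obtain C' where "closed C'" "T = S \<inter> C'" using T(2) by (auto simp: closedin_closed)
      then have "closure T \<subseteq> C'" by (intro closure_minimal) auto
      then show ?thesis using \<open>T = S \<inter> C'\<close> closure_subset[of T] by auto
    qed
    have TC: "T \<inter> C = {}" using T(3) openin_imp_subset[OF T(1)] by (auto simp: S_def)
    have "Some ` T \<subseteq> Y" using TC by (auto simp: Y_def)
    then have 1: "openin (subtopology ?X Y) (Some ` T)"
      unfolding openin_subtopology using opT by (intro exI[of _ "Some ` T"]) auto
    have "bounded T" using T(3) bounded_subset[OF bounded_cball] by blast
    \<comment> \<open>Boundedness enters here: the image of a closed planar set is closed in the
      sphere if the set is compact.\<close>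
    then have "closedin ?X (Some ` closure T)" by simp
    moreover have "Some ` T = Some ` closure T \<inter> Y"
    proof -
      have "closure T \<inter> - C \<subseteq> T" using cl by (auto simp: S_def)
      then show ?thesis using TC closure_subset[of T] by (auto simp: Y_def)
    qed
    ultimately have 2: "closedin (subtopology ?X Y) (Some ` T)"
      unfolding closedin_subtopology by blast
    have "connected_space (subtopology ?X Y)" using con by (simp add: connectedin_def Y_def)
    then have "Some ` T = {} \<or> Some ` T = topspace (subtopology ?X Y)"
      using 1 2 unfolding connected_space_clopen_in by blast
    moreover have "None \<in> topspace (subtopology ?X Y)" by (auto simp: Y_def)
    ultimately show "T = {}" by auto
  qed
  \<comment> \<open>The exterior of the disc is connected and lies in \<open>S\<close>, so a clopen
    set either misses it or contains it. The second case is reduced to the first by passing to the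
    complement in \<open>S\<close>.\<close>
  have "T = {} \<or> T = S" if T: "openin (top_of_set S) T" "closedin (top_of_set S) T" for T
  proof -
    have sub: "- cball 0 r \<subseteq> S" by (auto simp: S_def)
    have "openin (top_of_set (- cball 0 r)) (- cball 0 r \<inter> T)" "closedin (top_of_set (- cball 0 r)) (- cball 0 r \<inter> T)"
    proof -
      obtain C1 C2 where "open C1" "T = S \<inter> C1" "closed C2" "T = S \<inter> C2"
        using T by (auto simp: openin_open closedin_closed)
      moreover from this have "- cball 0 r \<inter> T = - cball 0 r \<inter> C1" "- cball 0 r \<inter> T = - cball 0 r \<inter> C2"
        using sub by blast+
      ultimately show "openin (top_of_set (- cball 0 r)) (- cball 0 r \<inter> T)"
        "closedin (top_of_set (- cball 0 r)) (- cball 0 r \<inter> T)"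
        unfolding openin_open closedin_closed by blast+
    qed
    then have "- cball 0 r \<inter> T = {} \<or> - cball 0 r \<inter> T = - cball 0 r"
      using outer unfolding connected_clopen by blast
    then show ?thesis
    proof
      assume "- cball 0 r \<inter> T = {}"
      then show ?thesis using empty[OF T] by blast
    next
      assume *: "- cball 0 r \<inter> T = - cball 0 r"
      have "openin (top_of_set S) (S - T)" "closedin (top_of_set S) (S - T)"
        using T by (auto intro: openin_diff closedin_diff)
      moreover have "(S - T) \<inter> - cball 0 r = {}" using * by blast
      ultimately have "S - T = {}" using empty by blast
      then show ?thesis using openin_imp_subset[OF T(1)] by blast
    qed
  qed
  then show ?thesis unfolding connected_clopen S_def[symmetric] by blast
qed

section \<open>Hankel determinants and Pade approximants\<close>

text \<open>Cramer's rule by the adjugate: apart from one division by the determinant the solution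
  is polynomial in the data. The equivalence gives existence and uniqueness of the Pade denominator
  at once.\<close>

lemma cramer_solution_iff:
  fixes A :: "complex Matrix.mat"
  assumes A: "A \<in> carrier_mat n n" and "Determinant.det A \<noteq> 0"
  shows "(\<forall>i<n. (\<Sum>k<n. A $$ (i, k) * x k) = b i) \<longleftrightarrow>
     (\<forall>k<n. x k = (\<Sum>i<n. adj_mat A $$ (k, i) * b i) / Determinant.det A)"
proof -
  let ?B = "adj_mat A" and ?d = "Determinant.det A"
  note B = adj_mat[OF A]
  have AB: "(\<Sum>k<n. A $$ (i, k) * ?B $$ (k, j)) = (if i = j then ?d else 0)" if "i < n" "j < n" for i j
  proof -
    have "(A * ?B) $$ (i, j) = (\<Sum>k<n. A $$ (i, k) * ?B $$ (k, j))"
      using that A B(1) by (simp add: scalar_prod_def atLeast0LessThan)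
    moreover have "(A * ?B) $$ (i, j) = (if i = j then ?d else 0)" unfolding B(2) using that by simp
    ultimately show ?thesis by simp
  qed
  have BA: "(\<Sum>k<n. ?B $$ (i, k) * A $$ (k, j)) = (if i = j then ?d else 0)" if "i < n" "j < n" for i j
  proof -
    have "(?B * A) $$ (i, j) = (\<Sum>k<n. ?B $$ (i, k) * A $$ (k, j))"
      using that A B(1) by (simp add: scalar_prod_def atLeast0LessThan)
    moreover have "(?B * A) $$ (i, j) = (if i = j then ?d else 0)" unfolding B(3) using that by simp
    ultimately show ?thesis by simp
  qed
  show ?thesis
  proof (intro iffI allI impI)
    fix k assume L: "\<forall>i<n. (\<Sum>k<n. A $$ (i, k) * x k) = b i" and k: "k < n"
    have "(\<Sum>i<n. ?B $$ (k, i) * b i) = (\<Sum>i<n. \<Sum>l<n. ?B $$ (k, i) * A $$ (i, l) * x l)"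
      using L by (intro sum.cong) (auto simp: sum_distrib_left mult.assoc simp flip: L)
    also have "\<dots> = (\<Sum>l<n. (\<Sum>i<n. ?B $$ (k, i) * A $$ (i, l)) * x l)"
      by (subst sum.swap) (simp add: sum_distrib_right)
    also have "\<dots> = (\<Sum>l<n. (if k = l then ?d else 0) * x l)"
      using k by (intro sum.cong) (auto simp: BA)
    also have "\<dots> = ?d * x k" using k by (simp add: if_distrib[of "\<lambda>u. u * _"] cong: if_cong)
    finally show "x k = (\<Sum>i<n. ?B $$ (k, i) * b i) / ?d" using assms(2) by simp
  next
    fix i assume R: "\<forall>k<n. x k = (\<Sum>i<n. ?B $$ (k, i) * b i) / ?d" and i: "i < n"
    have "(\<Sum>k<n. A $$ (i, k) * x k) = (\<Sum>k<n. \<Sum>j<n. A $$ (i, k) * ?B $$ (k, j) * (b j / ?d))"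
      using R by (intro sum.cong) (auto simp: sum_distrib_left sum_divide_distrib mult.assoc)
    also have "\<dots> = (\<Sum>j<n. (\<Sum>k<n. A $$ (i, k) * ?B $$ (k, j)) * (b j / ?d))"
      by (subst sum.swap) (simp add: sum_distrib_right sum_divide_distrib)
    also have "\<dots> = (\<Sum>j<n. (if i = j then ?d else 0) * (b j / ?d))"
      using i by (intro sum.cong) (auto simp: AB)
    also have "\<dots> = (\<Sum>j<n. if i = j then b j else 0)"
      by (intro sum.cong) (use assms(2) in auto)
    also have "\<dots> = b i" using i by simp
    finally show "(\<Sum>k<n. A $$ (i, k) * x k) = b i" .
  qed
qed

lemma tendsto_det:
  fixes A :: "'b \<Rightarrow> complex Matrix.mat"
  assumes "\<And>k. A k \<in> carrier_mat n n" "B \<in> carrier_mat n n"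
    "\<And>i j. i < n \<Longrightarrow> j < n \<Longrightarrow> ((\<lambda>k. A k $$ (i, j)) \<longlongrightarrow> B $$ (i, j)) G"
  shows "((\<lambda>k. Determinant.det (A k)) \<longlongrightarrow> Determinant.det B) G"
  unfolding det_def'[OF assms(1)] det_def'[OF assms(2)]
  by (intro tendsto_sum tendsto_mult tendsto_prod tendsto_const assms(3))
     (auto simp: permutes_in_image dest: permutes_in_image)

lemma tendsto_adj_mat:
  fixes A :: "'b \<Rightarrow> complex Matrix.mat"
  assumes A: "\<And>k. A k \<in> carrier_mat n n" and B: "B \<in> carrier_mat n n"
    and lim: "\<And>i j. i < n \<Longrightarrow> j < n \<Longrightarrow> ((\<lambda>k. A k $$ (i, j)) \<longlongrightarrow> B $$ (i, j)) G"
    and ij: "i < n" "j < n"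
  shows "((\<lambda>k. adj_mat (A k) $$ (i, j)) \<longlongrightarrow> adj_mat B $$ (i, j)) G"
proof -
  have dim: "dim_row (A k) = n" "dim_col (A k) = n" for k using A[of k] by auto
  have "((\<lambda>k. Determinant.det (mat_delete (A k) j i)) \<longlongrightarrow> Determinant.det (mat_delete B j i)) G"
  proof (rule tendsto_det[of _ "n - 1"])
    fix i' j' assume "i' < n - 1" "j' < n - 1"
    then show "((\<lambda>k. mat_delete (A k) j i $$ (i', j')) \<longlongrightarrow> mat_delete B j i $$ (i', j')) G"
      using B lim ij by (auto simp: mat_delete_def dim)
  qed (use B in \<open>auto simp: mat_delete_def dim\<close>)
  then show ?thesis
    using B ij dim by (simp add: adj_mat_def cofactor_def tendsto_mult_left)
qed

section \<open>The Pade equations of a formal power series\<close>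

definition fps_coeff :: "complex fps \<Rightarrow> int \<Rightarrow> complex" where
  "fps_coeff F i = (if i < 0 then 0 else fps_nth F (nat i))"

definition hankel :: "complex fps \<Rightarrow> nat \<Rightarrow> nat \<Rightarrow> complex Matrix.mat" where
  "hankel F p q = Matrix.mat q q (\<lambda>(i, j). fps_coeff F (int p - int q + int i + int j + 1))"

text \<open>The linearised problem: Q F - P vanishes to order p + q + 1. It replaces the Taylor
  condition on the quotient P / Q, which is not linear in Q.\<close>

definition pade_system :: "complex fps \<Rightarrow> nat \<Rightarrow> nat \<Rightarrow> complex poly \<Rightarrow> complex poly \<Rightarrow> bool" where
  "pade_system F p q P Q \<longleftrightarrow> degree P \<le> p \<and> degree Q \<le> q \<and> poly.coeff Q 0 = 1 \<and>
     (\<forall>v\<le>p + q. fps_nth (fps_of_poly Q * F) v = poly.coeff P v)"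

text \<open>The Hankel system determines the coefficients of the denominator in reverse order, hence the
  index \<open>q - j\<close>.\<close>

definition pade_den :: "complex fps \<Rightarrow> nat \<Rightarrow> nat \<Rightarrow> complex poly" where
  "pade_den F p q = (\<Sum>j\<le>q. monom (if j = 0 then 1 else
     (\<Sum>i<q. adj_mat (hankel F p q) $$ (q - j, i) * - fps_coeff F (int p + 1 + int i)) /
       Determinant.det (hankel F p q)) j)"

definition pade_num :: "complex fps \<Rightarrow> nat \<Rightarrow> nat \<Rightarrow> complex poly" where
  "pade_num F p q = (\<Sum>v\<le>p. monom (fps_nth (fps_of_poly (pade_den F p q) * F) v) v)"

lemma hankel_carrier: "hankel F p q \<in> carrier_mat q q"
  by (simp add: hankel_def)

lemma pade_regular_iff: "pade_regular f p q \<longleftrightarrow> Determinant.det (hankel (fps_expansion f 0) p q) \<noteq> 0"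
proof -
  \<comment> \<open>The empty determinant is 1, so the separate clause for q = 0 disappears.\<close>
  have "Determinant.det (hankel F p 0) = 1" for F p
    using hankel_carrier[of F p 0] by (rule det_dim_zero)
  then show ?thesis
    by (auto simp: pade_regular_def hankel_def taylor_coeff_def fps_coeff_def)
qed

lemma coeff_sum_monom: "poly.coeff (\<Sum>j\<le>n. monom (c j) j) k = (if k \<le> n then c k else 0)"
proof -
  have "poly.coeff (\<Sum>j\<le>n. monom (c j) j) k = (\<Sum>j\<le>n. if j = k then c j else 0)"
    by (simp add: coeff_sum)
  then show ?thesis by simp
qed

lemma coeff_pade_den:
  "poly.coeff (pade_den F p q) j = (if j = 0 then 1 else if j \<le> q then
     (\<Sum>i<q. adj_mat (hankel F p q) $$ (q - j, i) * - fps_coeff F (int p + 1 + int i)) /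
       Determinant.det (hankel F p q) else 0)"
  unfolding pade_den_def coeff_sum_monom by simp

lemma coeff_0_pade_den: "poly.coeff (pade_den F p q) 0 = 1"
  by (simp add: coeff_pade_den)

lemma degree_pade_den: "degree (pade_den F p q) \<le> q"
  by (intro degree_le) (auto simp: coeff_pade_den)

lemma coeff_pade_num:
  "poly.coeff (pade_num F p q) v = (if v \<le> p then fps_nth (fps_of_poly (pade_den F p q) * F) v else 0)"
  unfolding pade_num_def coeff_sum_monom ..

lemma degree_pade_num: "degree (pade_num F p q) \<le> p"
  by (intro degree_le) (auto simp: coeff_pade_num)

lemma fps_nth_poly_mult:
  assumes "degree Q \<le> q"
  shows "fps_nth (fps_of_poly Q * F) v = (\<Sum>j\<le>q. poly.coeff Q j * fps_coeff F (int v - int j))"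
proof -
  have "fps_nth (fps_of_poly Q * F) v = (\<Sum>j\<le>v. poly.coeff Q j * fps_coeff F (int v - int j))"
    by (auto simp: fps_mult_nth atLeast0AtMost fps_coeff_def nat_diff_distrib intro!: sum.cong)
  also have "\<dots> = (\<Sum>j\<le>v + q. poly.coeff Q j * fps_coeff F (int v - int j))"
    by (intro sum.mono_neutral_left) (auto simp: fps_coeff_def)
  also have "\<dots> = (\<Sum>j\<le>q. poly.coeff Q j * fps_coeff F (int v - int j))"
    using assms by (intro sum.mono_neutral_right) (auto intro: coeff_eq_0)
  finally show ?thesis .
qed

text \<open>The numerator places no constraint beyond degree p, so the equations for the denominator
  are the q coefficients of Q F in degrees p + 1 to p + q.\<close>

lemma hankel_system_iff:
  assumes "degree Q \<le> q" "poly.coeff Q 0 = 1"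
  shows "(\<forall>v. p < v \<and> v \<le> p + q \<longrightarrow> fps_nth (fps_of_poly Q * F) v = 0) \<longleftrightarrow>
    (\<forall>i<q. (\<Sum>k<q. hankel F p q $$ (i, k) * poly.coeff Q (q - k)) = - fps_coeff F (int p + 1 + int i))"
proof -
  have "(\<forall>v. p < v \<and> v \<le> p + q \<longrightarrow> fps_nth (fps_of_poly Q * F) v = 0) \<longleftrightarrow>
    (\<forall>i<q. fps_nth (fps_of_poly Q * F) (p + 1 + i) = 0)"
  proof safe
    fix v assume *: "\<forall>i<q. fps_nth (fps_of_poly Q * F) (p + 1 + i) = 0" "p < v" "v \<le> p + q"
    then show "fps_nth (fps_of_poly Q * F) v = 0" using *(1)[rule_format, of "v - p - 1"] by simp
  qed auto
  moreover
  have "fps_nth (fps_of_poly Q * F) (p + 1 + i) =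
     (\<Sum>k<q. hankel F p q $$ (i, k) * poly.coeff Q (q - k)) + fps_coeff F (int p + 1 + int i)" if "i < q" for i
  proof -
    have "fps_nth (fps_of_poly Q * F) (p + 1 + i)
        = (\<Sum>j\<le>q. poly.coeff Q j * fps_coeff F (int (p + 1 + i) - int j))"
      by (rule fps_nth_poly_mult[OF assms(1)])
    \<comment> \<open>Reversing the order of the unknowns turns the index p + 1 + i - j into p - q +
      i + k + 1, the Hankel form. The last term, k = q, belongs to the known coefficient 1 of Q and
      becomes the right-hand side.\<close>
    also have "\<dots> = (\<Sum>k\<le>q. poly.coeff Q (q - k) * fps_coeff F (int (p + 1 + i) - int (q - k)))"
      by (rule sum.reindex_bij_witness[of _ "\<lambda>k. q - k" "\<lambda>k. q - k"]) auto
    also have "\<dots> = (\<Sum>k<q. poly.coeff Q (q - k) * fps_coeff F (int (p + 1 + i) - int (q - k)))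
        + fps_coeff F (int (p + 1 + i))"
      by (simp add: assms(2) flip: lessThan_Suc_atMost)
    also have "(\<Sum>k<q. poly.coeff Q (q - k) * fps_coeff F (int (p + 1 + i) - int (q - k)))
        = (\<Sum>k<q. hankel F p q $$ (i, k) * poly.coeff Q (q - k))"
      using that by (intro sum.cong) (auto simp: hankel_def of_nat_diff algebra_simps)
    finally show ?thesis by (simp add: add.assoc add.commute add.left_commute)
  qed
  then have "fps_nth (fps_of_poly Q * F) (p + 1 + i) = 0 \<longleftrightarrow>
     (\<Sum>k<q. hankel F p q $$ (i, k) * poly.coeff Q (q - k)) = - fps_coeff F (int p + 1 + int i)" if "i < q" for i
    using that by (simp only: eq_neg_iff_add_eq_0)
  then have "(\<forall>i<q. fps_nth (fps_of_poly Q * F) (p + 1 + i) = 0) \<longleftrightarrow>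
    (\<forall>i<q. (\<Sum>k<q. hankel F p q $$ (i, k) * poly.coeff Q (q - k)) = - fps_coeff F (int p + 1 + int i))"
    by (rule all_cong)
  ultimately show ?thesis by (rule trans)
qed

lemma pade_system_pade_den:
  assumes "Determinant.det (hankel F p q) \<noteq> 0"
  shows "pade_system F p q (pade_num F p q) (pade_den F p q)"
proof -
  have "\<forall>k<q. poly.coeff (pade_den F p q) (q - k) =
     (\<Sum>i<q. adj_mat (hankel F p q) $$ (k, i) * - fps_coeff F (int p + 1 + int i)) / Determinant.det (hankel F p q)"
    by (simp add: coeff_pade_den)
  then have "\<forall>v. p < v \<and> v \<le> p + q \<longrightarrow> fps_nth (fps_of_poly (pade_den F p q) * F) v = 0"
    unfolding hankel_system_iff[OF degree_pade_den coeff_0_pade_den] cramer_solution_iff[OF hankel_carrier assms] .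
  then show ?thesis
    using degree_pade_den degree_pade_num
    by (auto simp: pade_system_def coeff_pade_num) (simp add: coeff_pade_den)
qed

lemma pade_system_unique:
  assumes "Determinant.det (hankel F p q) \<noteq> 0" "pade_system F p q P Q"
  shows "P = pade_num F p q" "Q = pade_den F p q"
proof -
  have Q: "degree Q \<le> q" "poly.coeff Q 0 = 1" "degree P \<le> p"
    and eq: "\<And>v. v \<le> p + q \<Longrightarrow> fps_nth (fps_of_poly Q * F) v = poly.coeff P v"
    using assms(2) by (auto simp: pade_system_def)
  have "\<forall>v. p < v \<and> v \<le> p + q \<longrightarrow> fps_nth (fps_of_poly Q * F) v = 0"
    using eq Q(3) by (auto intro: coeff_eq_0)
  then have *: "\<forall>k<q. poly.coeff Q (q - k) =
     (\<Sum>i<q. adj_mat (hankel F p q) $$ (k, i) * - fps_coeff F (int p + 1 + int i)) / Determinant.det (hankel F p q)"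
    unfolding hankel_system_iff[OF Q(1,2)] cramer_solution_iff[OF hankel_carrier assms(1)] .
  show den: "Q = pade_den F p q"
  proof (rule poly_eqI)
    fix j
    consider "j = 0" | "0 < j" "j \<le> q" | "q < j" by linarith
    then show "poly.coeff Q j = poly.coeff (pade_den F p q) j"
    proof cases
      case 2
      then show ?thesis using *[rule_format, of "q - j"] by (simp add: coeff_pade_den)
    qed (use Q in \<open>auto simp: coeff_pade_den intro: coeff_eq_0\<close>)
  qed
  show "P = pade_num F p q"
  proof (rule poly_eqI)
    fix v show "poly.coeff P v = poly.coeff (pade_num F p q) v"
      using eq[of v] Q(3) by (cases "v \<le> p") (auto simp: coeff_pade_num den intro: coeff_eq_0)
  qed
qed

text \<open>A series with constant term 1 is a unit, so multiplying by it does not change the order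
  of vanishing. This moves between Q F - P and F - P / Q.\<close>

lemma fps_mult_vanish_iff:
  fixes A B :: "complex fps"
  assumes "fps_nth A 0 = 1"
  shows "(\<forall>v\<le>n. fps_nth (A * B) v = 0) \<longleftrightarrow> (\<forall>v\<le>n. fps_nth B v = 0)"
proof
  assume L: "\<forall>v\<le>n. fps_nth (A * B) v = 0"
  have "v \<le> n \<Longrightarrow> fps_nth B v = 0" for v
  proof (induction v rule: less_induct)
    case (less v)
    have "fps_nth (A * B) v = (\<Sum>i\<le>v. fps_nth A i * fps_nth B (v - i))"
      by (simp add: fps_mult_nth atLeast0AtMost)
    also have "\<dots> = (\<Sum>i\<in>{0}. fps_nth A i * fps_nth B (v - i))"
      using less by (intro sum.mono_neutral_right) auto
    finally show ?case using L less assms by simp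
  qed
  then show "\<forall>v\<le>n. fps_nth B v = 0" by blast
qed (simp add: fps_mult_nth)

lemma has_fps_expansion_poly: "(\<lambda>z::complex. poly P z) has_fps_expansion fps_of_poly P"
proof (induction P)
  case (pCons a P)
  have "(\<lambda>z. a + z * poly P z) has_fps_expansion (fps_const a + fps_X * fps_of_poly P)"
    by (intro fps_expansion_intros pCons)
  then show ?case by (simp add: fps_of_poly_pCons mult.commute)
qed auto

text \<open>\<open>rat_eval\<close> and \<open>rat_poles\<close> use the reduced fraction, whose
  denominator need not have constant coefficient 1; here it is rescaled to the normalisation of the
  Pade problem.\<close>

lemma Fract_reduced:
  fixes P Q :: "complex poly"
  assumes "poly.coeff Q 0 = 1"
  obtains P' Q' where "Fraction_Field.Fract P Q = Fraction_Field.Fract P' Q'" "degree P' \<le> degree P"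
    "degree Q' \<le> degree Q" "poly.coeff Q' 0 = 1" "P' * Q = P * Q'"
    "rat_eval (Fraction_Field.Fract P Q) = (\<lambda>z. poly P' z / poly Q' z)"
    "rat_poles (Fraction_Field.Fract P Q) = {z. poly Q' z = 0}"
proof -
  define r where "r = Fraction_Field.Fract P Q"
  define P0 Q0 where "P0 = fst (quot_of_fract r)" and "Q0 = snd (quot_of_fract r)"
  have Q: "Q \<noteq> 0" using assms by auto
  have Q0: "Q0 \<noteq> 0" by (simp add: Q0_def)
  have r0: "r = Fraction_Field.Fract P0 Q0" by (simp add: P0_def Q0_def)
  have cop: "coprime P0 Q0" unfolding P0_def Q0_def by (rule coprime_quot_of_fract)
  have cross: "P0 * Q = P * Q0" using r0 Q Q0 by (simp add: r_def eq_fract)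
  have "Q0 dvd P0 * Q" using cross by simp
  then have "Q0 dvd Q" using cop by (simp add: coprime_commute coprime_dvd_mult_right_iff)
  then obtain C where C: "Q = Q0 * C" by blast
  then have PC: "P = P0 * C" using cross Q0 by (simp add: mult.left_commute mult.commute)
  \<comment> \<open>The reduced denominator divides \<open>Q\<close>, and \<open>Q\<close> has
    constant coefficient 1, so c is nonzero and can be divided out.\<close>
  define c where "c = poly.coeff Q0 0"
  have c: "c \<noteq> 0" using assms C by (auto simp: c_def coeff_mult_0)
  define P' Q' where "P' = Polynomial.smult (1 / c) P0" and "Q' = Polynomial.smult (1 / c) Q0"
  have "C \<noteq> 0" using C Q by auto
  have "degree P0 \<le> degree P" unfolding PC using \<open>C \<noteq> 0\<close> by (cases "P0 = 0") (auto simp: degree_mult_eq)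
  moreover have "degree Q0 \<le> degree Q" unfolding C using \<open>C \<noteq> 0\<close> Q0 by (auto simp: degree_mult_eq)
  moreover have "r = Fraction_Field.Fract P' Q'"
    using c Q0 by (simp add: r0 P'_def Q'_def eq_fract mult.commute)
  moreover have "P' * Q = P * Q'" using cross by (simp add: P'_def Q'_def)
  moreover have "rat_eval r = (\<lambda>z. poly P' z / poly Q' z)" "rat_poles r = {z. poly Q' z = 0}"
    using c by (auto simp: rat_eval_def rat_poles_def P'_def Q'_def P0_def Q0_def)
  ultimately show ?thesis
    using that[of P' Q'] c unfolding r_def[symmetric] by (auto simp: P'_def Q'_def c_def)
qed

lemma taylor_agreement_iff:
  assumes "poly.coeff Q 0 = 1"
  shows "(\<forall>v\<le>n. fps_nth (fps_expansion (\<lambda>z. poly P z / poly Q z) 0) v = fps_nth F v) \<longleftrightarrow>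
    (\<forall>v\<le>n. fps_nth (fps_of_poly Q * F) v = poly.coeff P v)"
proof -
  let ?G = "fps_of_poly P / fps_of_poly Q"
  have Q0: "fps_nth (fps_of_poly Q) 0 = 1" using assms by simp
  have "fps_expansion (\<lambda>z. poly P z / poly Q z) 0 = ?G"
    by (intro fps_expansion_eqI has_fps_expansion_divide' has_fps_expansion_poly) (simp add: assms)
  moreover have "fps_of_poly Q * ?G = fps_of_poly P"
    using Q0 by (simp add: fps_divide_unit mult.left_commute[of _ "fps_of_poly P"] inverse_mult_eq_1')
  then have eq: "fps_of_poly Q * (F - ?G) = fps_of_poly Q * F - fps_of_poly P"
    by (simp add: right_diff_distrib)
  have "(\<forall>v\<le>n. fps_nth (fps_of_poly Q * F - fps_of_poly P) v = 0) \<longleftrightarrow> (\<forall>v\<le>n. fps_nth (F - ?G) v = 0)"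
    using fps_mult_vanish_iff[OF Q0, of n "F - ?G"] unfolding eq .
  then have "(\<forall>v\<le>n. fps_nth (fps_of_poly Q * F) v = poly.coeff P v) \<longleftrightarrow> (\<forall>v\<le>n. fps_nth F v = fps_nth ?G v)"
    by (simp only: fps_sub_nth right_minus_eq fps_of_poly_nth)
  ultimately show ?thesis by (auto simp only:)
qed

text \<open>The second claim contains that numerator and denominator of the Cramer solution have no
  common zero hiding a pole: the reduced form of the approximant is itself a solution of the system,
  hence equal to it.\<close>

lemma pade_regular_pade:
  assumes "pade_regular f p q"
  defines "F \<equiv> fps_expansion f 0"
  shows "rat_eval (pade f p q) = (\<lambda>z. poly (pade_num F p q) z / poly (pade_den F p q) z)"
    and "rat_poles (pade f p q) = {z. poly (pade_den F p q) z = 0}"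
proof -
  let ?N = "pade_num F p q" and ?D = "pade_den F p q"
  have det: "Determinant.det (hankel F p q) \<noteq> 0" using assms by (simp add: pade_regular_iff)
  have unique: "r = Fraction_Field.Fract ?N ?D \<and> rat_eval r = (\<lambda>z. poly ?N z / poly ?D z)
      \<and> rat_poles r = {z. poly ?D z = 0}" if pade: "is_pade f p q r" for r
  proof -
    obtain P Q where PQ: "degree P \<le> p" "degree Q \<le> q" "poly.coeff Q 0 = 1" "r = Fraction_Field.Fract P Q"
      and agree: "\<forall>v\<le>p + q. fps_nth (fps_expansion (rat_eval r) 0) v = fps_nth F v"
      using pade unfolding is_pade_def F_def[symmetric] by (elim conjE exE) (rule that)
    obtain P' Q' where *: "Fraction_Field.Fract P Q = Fraction_Field.Fract P' Q'" "degree P' \<le> degree P"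
      "degree Q' \<le> degree Q" "poly.coeff Q' 0 = 1"
      "rat_eval (Fraction_Field.Fract P Q) = (\<lambda>z. poly P' z / poly Q' z)"
      "rat_poles (Fraction_Field.Fract P Q) = {z. poly Q' z = 0}"
      by (rule Fract_reduced[OF PQ(3), of P]) (rule that)
    \<comment> \<open>Reduction does not raise degrees and the normalisation survives, so the
      reduced pair satisfies all the equations and uniqueness applies to it.\<close>
    have "pade_system F p q P' Q'"
      using PQ * agree taylor_agreement_iff[OF *(4), of "p + q" P' F] by (simp add: pade_system_def)
    then have "P' = ?N" "Q' = ?D" using pade_system_unique[OF det] by blast+
    then show ?thesis using * PQ(4) by simp
  qed
  have ex: "is_pade f p q (Fraction_Field.Fract ?N ?D)"
  proof -
    have sys: "pade_system F p q ?N ?D" using pade_system_pade_den[OF det] .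
    then have D0: "poly.coeff ?D 0 = 1" by (simp add: pade_system_def)
    obtain P' Q' where *: "poly.coeff Q' 0 = 1" "P' * ?D = ?N * Q'"
      "rat_eval (Fraction_Field.Fract ?N ?D) = (\<lambda>z. poly P' z / poly Q' z)"
      by (rule Fract_reduced[OF D0, of ?N]) (rule that)
    \<comment> \<open>Both sides equal D Q' F - D P', by the cross relation. Since D and Q' are
      units, the order of contact of the Cramer pair passes to the reduced pair.\<close>
    have "fps_of_poly ?D * (fps_of_poly Q' * F - fps_of_poly P') = fps_of_poly Q' * (fps_of_poly ?D * F - fps_of_poly ?N)"
      using *(2) by (simp add: right_diff_distrib mult_ac flip: fps_of_poly_mult)
    moreover have "\<forall>v\<le>p + q. fps_nth (fps_of_poly ?D * F - fps_of_poly ?N) v = 0"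
      using sys by (simp add: pade_system_def)
    ultimately have "\<forall>v\<le>p + q. fps_nth (fps_of_poly Q' * F - fps_of_poly P') v = 0"
      using fps_mult_vanish_iff[of "fps_of_poly ?D" "p + q" "fps_of_poly Q' * F - fps_of_poly P'"]
        fps_mult_vanish_iff[of "fps_of_poly Q'" "p + q" "fps_of_poly ?D * F - fps_of_poly ?N"] D0 *(1)
      by simp
    then have "\<forall>v\<le>p + q. fps_nth (fps_expansion (rat_eval (Fraction_Field.Fract ?N ?D)) 0) v = fps_nth F v"
      unfolding *(3) taylor_agreement_iff[OF *(1)] by simp
    then show ?thesis
      unfolding is_pade_def F_def[symmetric] using degree_pade_num degree_pade_den D0 by blast
  qed
  then have "is_pade f p q (pade f p q)"
    unfolding pade_def by (rule theI) (use unique in blast)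
  then show "rat_eval (pade f p q) = (\<lambda>z. poly ?N z / poly ?D z)"
    and "rat_poles (pade f p q) = {z. poly ?D z = 0}"
    using unique by blast+
qed

section \<open>Continuity of the Pade coefficients, and the Hankel determinant of a
  polynomial\<close>

lemma tendsto_hankel:
  assumes "\<And>v. ((\<lambda>k. fps_nth (F k) v) \<longlongrightarrow> fps_nth F' v) G"
  shows "((\<lambda>k. Determinant.det (hankel (F k) p q)) \<longlongrightarrow> Determinant.det (hankel F' p q)) G"
    and "i < q \<Longrightarrow> j < q \<Longrightarrow> ((\<lambda>k. adj_mat (hankel (F k) p q) $$ (i, j)) \<longlongrightarrow> adj_mat (hankel F' p q) $$ (i, j)) G"
proof -
  have "((\<lambda>k. hankel (F k) p q $$ (i, j)) \<longlongrightarrow> hankel F' p q $$ (i, j)) G" if "i < q" "j < q" for i j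
    using that assms by (simp add: hankel_def fps_coeff_def)
  then show "((\<lambda>k. Determinant.det (hankel (F k) p q)) \<longlongrightarrow> Determinant.det (hankel F' p q)) G"
    and "i < q \<Longrightarrow> j < q \<Longrightarrow> ((\<lambda>k. adj_mat (hankel (F k) p q) $$ (i, j)) \<longlongrightarrow> adj_mat (hankel F' p q) $$ (i, j)) G"
    by (auto intro!: tendsto_det[OF hankel_carrier hankel_carrier] tendsto_adj_mat[OF hankel_carrier hankel_carrier])
qed

lemma tendsto_coeff_pade:
  assumes lim: "\<And>v. ((\<lambda>k. fps_nth (F k) v) \<longlongrightarrow> fps_nth F' v) G"
    and det: "Determinant.det (hankel F' p q) \<noteq> 0"
  shows "((\<lambda>k. poly.coeff (pade_den (F k) p q) v) \<longlongrightarrow> poly.coeff (pade_den F' p q) v) G"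
    and "((\<lambda>k. poly.coeff (pade_num (F k) p q) v) \<longlongrightarrow> poly.coeff (pade_num F' p q) v) G"
proof -
  have c: "((\<lambda>k. fps_coeff (F k) i) \<longlongrightarrow> fps_coeff F' i) G" for i
    using lim by (simp add: fps_coeff_def)
  show D: "((\<lambda>k. poly.coeff (pade_den (F k) p q) v) \<longlongrightarrow> poly.coeff (pade_den F' p q) v) G" for v
  proof (cases "0 < v \<and> v \<le> q")
    case True
    then show ?thesis
      by (simp add: coeff_pade_den) (intro tendsto_intros tendsto_hankel lim det c; simp)
  qed (auto simp: coeff_pade_den)
  show "((\<lambda>k. poly.coeff (pade_num (F k) p q) v) \<longlongrightarrow> poly.coeff (pade_num F' p q) v) G"
    using D lim by (auto simp: coeff_pade_num fps_mult_nth intro!: tendsto_intros)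
qed

text \<open>With the rows in reverse order, entry (i, j) is the coefficient of index p - i + j. It
  vanishes above the diagonal, where the index exceeds the degree, and is the leading coefficient on
  the diagonal.\<close>

lemma det_hankel_poly:
  assumes "degree P = p" "P \<noteq> 0"
  shows "Determinant.det (hankel (fps_of_poly P) p q) \<noteq> 0"
proof -
  let ?A = "hankel (fps_of_poly P) p q"
  define \<pi> where "\<pi> = (\<lambda>i. if i < q then q - 1 - i else i)"
  have \<pi>: "\<pi> permutes {0..<q}"
  proof (rule bij_imp_permutes)
    show "bij_betw \<pi> {0..<q} {0..<q}"
      by (rule bij_betwI[of _ _ _ \<pi>]) (auto simp: \<pi>_def)
  qed (auto simp: \<pi>_def)
  define B where "B = Matrix.mat q q (\<lambda>(i, j). ?A $$ (\<pi> i, j))"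
  have B: "B $$ (i, j) = fps_coeff (fps_of_poly P) (int p - int i + int j)" if "i < q" "j < q" for i j
    using that by (simp add: B_def hankel_def \<pi>_def of_nat_diff algebra_simps)
  have "Determinant.det B = prod_list (diag_mat B)"
  proof (rule det_lower_triangular)
    fix i j assume "i < j" "j < q"
    then show "B $$ (i, j) = 0"
      using assms by (auto simp: B fps_coeff_def intro!: coeff_eq_0)
  qed (simp add: B_def)
  also have "\<dots> \<noteq> 0"
    using assms by (auto simp: prod_list_zero_iff diag_mat_def B fps_coeff_def B_def[THEN arg_cong[of _ _ dim_row]])
  finally have "Determinant.det B \<noteq> 0" .
  moreover have "Determinant.det B = signof \<pi> * Determinant.det ?A"
    unfolding B_def by (rule det_permute_rows[OF hankel_carrier \<pi>])
  ultimately show ?thesis by auto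
qed

section \<open>The metric space of the functions smooth up to the boundary\<close>

definition weighted_sum :: "(nat \<Rightarrow> nat \<Rightarrow> real) \<Rightarrow> real" where
  "weighted_sum a = (\<Sum>l. \<Sum>n. (1/2) ^ (l + Suc n) * a l n)"

lemma half_powers_sums: "(\<lambda>n. (1/2) ^ (l + Suc n)) sums ((1/2) ^ l :: real)"
proof -
  have "(\<lambda>n. (1/2) ^ l * (1/2) ^ Suc n) sums ((1/2) ^ l * 1 :: real)"
    by (intro sums_mult power_half_series)
  then show ?thesis by (simp add: power_add)
qed

lemma weighted_inner_summable:
  fixes a :: "nat \<Rightarrow> nat \<Rightarrow> real"
  assumes "\<And>l n. 0 \<le> a l n" "\<And>l n. a l n \<le> 1"
  shows "summable (\<lambda>n. (1/2) ^ (l + Suc n) * a l n)"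
    and "(\<Sum>n. (1/2) ^ (l + Suc n) * a l n) \<le> (1/2) ^ l" "0 \<le> (\<Sum>n. (1/2) ^ (l + Suc n) * a l n)"
proof -
  have le: "(1/2) ^ (l + Suc n) * a l n \<le> (1/2) ^ (l + Suc n)" for n
    using assms(2)[of l n] by (intro mult_left_le) auto
  show s: "summable (\<lambda>n. (1/2) ^ (l + Suc n) * a l n)"
    using le assms(1) by (intro summable_comparison_test'[OF sums_summable[OF half_powers_sums[of l]]]) auto
  show "(\<Sum>n. (1/2) ^ (l + Suc n) * a l n) \<le> (1/2) ^ l"
    using suminf_le[OF le s sums_summable[OF half_powers_sums]] sums_unique[OF half_powers_sums[of l]] by simp
  show "0 \<le> (\<Sum>n. (1/2) ^ (l + Suc n) * a l n)" by (intro suminf_nonneg s) (simp add: assms)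
qed

lemma weighted_outer_summable:
  fixes a :: "nat \<Rightarrow> nat \<Rightarrow> real"
  assumes "\<And>l n. 0 \<le> a l n" "\<And>l n. a l n \<le> 1"
  shows "summable (\<lambda>l. \<Sum>n. (1/2) ^ (l + Suc n) * a l n)"
proof (rule summable_comparison_test'[of "\<lambda>l. (1/2) ^ l :: real" 0])
  show "norm (\<Sum>n. (1/2) ^ (l + Suc n) * a l n) \<le> (1/2) ^ l" for l
    using weighted_inner_summable(2,3)[of a l, OF assms] by simp
qed simp

lemma weighted_sum_nonneg:
  assumes "\<And>l n. 0 \<le> a l n" "\<And>l n. a l n \<le> 1"
  shows "0 \<le> weighted_sum a"
  unfolding weighted_sum_def
  by (intro suminf_nonneg weighted_outer_summable weighted_inner_summable assms)

lemma weighted_sum_triangle: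
  assumes a: "\<And>l n. 0 \<le> a l n" "\<And>l n. a l n \<le> 1"
    and b: "\<And>l n. 0 \<le> b l n" "\<And>l n. b l n \<le> 1"
    and c: "\<And>l n. 0 \<le> c l n" "\<And>l n. c l n \<le> 1"
    and le: "\<And>l n. a l n \<le> b l n + c l n"
  shows "weighted_sum a \<le> weighted_sum b + weighted_sum c"
proof -
  let ?s = "\<lambda>a l. \<Sum>n. (1/2) ^ (l + Suc n) * a l n :: real"
  have inner: "?s a l \<le> ?s b l + ?s c l" for l
  proof -
    have "?s a l \<le> (\<Sum>n. (1/2) ^ (l + Suc n) * b l n + (1/2) ^ (l + Suc n) * c l n)"
      by (intro suminf_le weighted_inner_summable(1) summable_add a b c)
        (simp add: le flip: distrib_left)
    also have "\<dots> = ?s b l + ?s c l"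
      by (intro suminf_add[symmetric] weighted_inner_summable(1) b c)
    finally show ?thesis .
  qed
  have "suminf (?s a) \<le> (\<Sum>l. ?s b l + ?s c l)"
    by (intro suminf_le inner weighted_outer_summable summable_add a b c)
  also have "\<dots> = suminf (?s b) + suminf (?s c)"
    by (intro suminf_add[symmetric] weighted_outer_summable b c)
  finally show ?thesis by (simp only: weighted_sum_def)
qed

lemma weighted_sum_ge_term:
  assumes "\<And>l n. 0 \<le> a l n" "\<And>l n. a l n \<le> 1"
  shows "(1/2) ^ (l + Suc n) * a l n \<le> weighted_sum a"
proof -
  have "(1/2) ^ (l + Suc n) * a l n \<le> (\<Sum>n. (1/2) ^ (l + Suc n) * a l n)"
    using sum_le_suminf[OF weighted_inner_summable(1)[of a l, OF assms], of "{n}"] assms(1) by simp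
  also have "\<dots> \<le> weighted_sum a"
    unfolding weighted_sum_def
    using sum_le_suminf[OF weighted_outer_summable[of a, OF assms], of "{l}"] weighted_inner_summable(3)[of a, OF assms]
    by simp
  finally show ?thesis .
qed

text \<open>Tannery's theorem, dominated convergence for series, is applied to the inner and then to
  the outer sum; the geometric weights dominate.\<close>

lemma weighted_sum_tendsto_0:
  fixes a :: "'b \<Rightarrow> nat \<Rightarrow> nat \<Rightarrow> real"
  assumes a: "\<And>i l n. 0 \<le> a i l n" "\<And>i l n. a i l n \<le> 1"
    and lim: "\<And>l n. ((\<lambda>i. a i l n) \<longlongrightarrow> 0) G" and G: "G \<noteq> bot"
  shows "((\<lambda>i. weighted_sum (a i)) \<longlongrightarrow> 0) G"
proof -
  have inner: "((\<lambda>i. \<Sum>n. (1/2) ^ (l + Suc n) * a i l n) \<longlongrightarrow> (\<Sum>n. 0)) G" for l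
  proof (rule tannerys_theorem[THEN conjunct2, THEN conjunct2])
    show "((\<lambda>i. (1/2) ^ (l + Suc n) * a i l n) \<longlongrightarrow> 0) G" for n
      by (rule tendsto_mult_right_zero[OF lim])
    show "\<forall>\<^sub>F (n, i) in sequentially \<times>\<^sub>F G. norm ((1/2) ^ (l + Suc n) * a i l n) \<le> (1/2) ^ (l + Suc n)"
      using a by (auto intro!: always_eventually mult_left_le)
    show "summable (\<lambda>n. (1/2) ^ (l + Suc n) :: real)" using half_powers_sums sums_summable by blast
  qed (rule G)
  have "((\<lambda>i. \<Sum>l. \<Sum>n. (1/2) ^ (l + Suc n) * a i l n) \<longlongrightarrow> (\<Sum>l. 0)) G"
  proof (rule tannerys_theorem[THEN conjunct2, THEN conjunct2])
    show "((\<lambda>i. \<Sum>n. (1/2) ^ (l + Suc n) * a i l n) \<longlongrightarrow> 0) G" for l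
      using inner[of l] by simp
    show "\<forall>\<^sub>F (l, i) in sequentially \<times>\<^sub>F G. norm (\<Sum>n. (1/2) ^ (l + Suc n) * a i l n) \<le> (1/2) ^ l"
      using weighted_inner_summable(2,3)[of "a _", OF a] by (intro always_eventually) auto
  qed (use G in simp_all)
  then show ?thesis by (simp add: weighted_sum_def)
qed

section \<open>Extended derivatives and the seminorms over compact pieces of the closure\<close>

locale A_infty_domain =
  fixes \<Omega> :: "complex set"
  assumes open_domain: "open \<Omega>" and zero_in_domain: "0 \<in> \<Omega>"
begin

abbreviation "D \<equiv> deriv_ext \<Omega>"
abbreviation "A \<equiv> A_infty \<Omega>"
abbreviation "m \<equiv> A_infty_metric \<Omega>"

definition trunc :: "nat \<Rightarrow> complex set" where "trunc n = closure \<Omega> \<inter> cball 0 (real n)"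

lemma compact_trunc: "compact (trunc n)"
  unfolding trunc_def by (intro closed_Int_compact) auto

text \<open>Ensures that the suprema defining the seminorms run over nonempty sets, even for n =
  0.\<close>

lemma zero_in_trunc: "0 \<in> trunc n"
  using zero_in_domain closure_subset by (auto simp: trunc_def)

lemma trunc_subset: "trunc n \<subseteq> closure \<Omega>"
  by (auto simp: trunc_def)

lemma trunc_mono: "k \<le> n \<Longrightarrow> trunc k \<subseteq> trunc n"
  by (auto simp: trunc_def)

text \<open>A point in the closure of an open set is a limit point of it, so the limit defining
  \<open>deriv_ext\<close> is unique and agrees with any continuous extension.\<close>

lemma deriv_ext_eqI:
  assumes "continuous_on (closure \<Omega>) g" "\<And>z. z \<in> \<Omega> \<Longrightarrow> g z = (deriv ^^ l) f z" "z \<in> closure \<Omega>"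
  shows "D l f z = g z"
proof -
  have "z islimpt \<Omega>"
    using assms(3) open_domain interior_limit_point[of z \<Omega>] by (auto simp: closure_def interior_open)
  then have nt: "\<not> trivial_limit (at z within \<Omega>)" by (simp add: trivial_limit_within)
  have "(g \<longlongrightarrow> g z) (at z within closure \<Omega>)"
    using assms(1,3) by (simp add: continuous_on_def)
  then have "(g \<longlongrightarrow> g z) (at z within \<Omega>)"
    by (rule tendsto_within_subset) (rule closure_subset)
  moreover have "\<forall>\<^sub>F x in at z within \<Omega>. g x = (deriv ^^ l) f x"
    using assms(2) by (auto simp: eventually_at_filter)
  ultimately have "((deriv ^^ l) f \<longlongrightarrow> g z) (at z within \<Omega>)"
    by (rule Lim_transform_eventually)
  then show ?thesis unfolding deriv_ext_def using nt by (intro tendsto_Lim)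
qed

lemma A_inftyD:
  assumes "f \<in> A"
  shows "f \<in> extensional \<Omega>" "f holomorphic_on \<Omega>" "continuous_on (closure \<Omega>) (D l f)"
    "z \<in> \<Omega> \<Longrightarrow> D l f z = (deriv ^^ l) f z"
proof -
  show "f \<in> extensional \<Omega>" "f holomorphic_on \<Omega>" using assms by (auto simp: A_infty_def)
  obtain g where g: "continuous_on (closure \<Omega>) g" "\<And>z. z \<in> \<Omega> \<Longrightarrow> g z = (deriv ^^ l) f z"
    using assms unfolding A_infty_def by blast
  have eq: "D l f z = g z" if "z \<in> closure \<Omega>" for z
    using deriv_ext_eqI[OF g that] .
  show "continuous_on (closure \<Omega>) (D l f)"
    by (rule continuous_on_eq[OF g(1)]) (simp add: eq)
  show "D l f z = (deriv ^^ l) f z" if "z \<in> \<Omega>"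
    using eq[of z] g(2)[OF that] that closure_subset[of \<Omega>] by auto
qed

lemma continuous_on_trunc: "f \<in> A \<Longrightarrow> continuous_on (trunc n) (D l f)"
  by (rule continuous_on_subset[OF A_inftyD(3) trunc_subset])

lemma A_inftyI:
  assumes "f \<in> extensional \<Omega>" "f holomorphic_on \<Omega>"
    "\<And>l. continuous_on (closure \<Omega>) (g l)" "\<And>l z. z \<in> \<Omega> \<Longrightarrow> g l z = (deriv ^^ l) f z"
  shows "f \<in> A"
  using assms unfolding A_infty_def by blast

text \<open>At boundary points the extended derivative is the ordinary derivative of
  \<open>h\<close>; the derivative of the restricted function carries no such information
  there.\<close>

lemma restrict_holomorphic:
  assumes "open U" "closure \<Omega> \<subseteq> U" "h holomorphic_on U"
  shows "restrict h \<Omega> \<in> A" "z \<in> closure \<Omega> \<Longrightarrow> D l (restrict h \<Omega>) z = (deriv ^^ l) h z"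
proof -
  have hol: "h holomorphic_on \<Omega>" using assms(2,3) closure_subset holomorphic_on_subset by blast
  have hr: "restrict h \<Omega> holomorphic_on \<Omega>" using hol by (auto cong: holomorphic_cong)
  have d: "(deriv ^^ l) h z = (deriv ^^ l) (restrict h \<Omega>) z" if "z \<in> \<Omega>" for l z
    by (rule higher_deriv_transform_within_open[OF hol hr open_domain that]) auto
  have c: "continuous_on (closure \<Omega>) ((deriv ^^ l) h)" for l
    using holomorphic_higher_deriv[OF assms(3,1)] assms(2)
    by (meson continuous_on_subset holomorphic_on_imp_continuous_on)
  show "restrict h \<Omega> \<in> A" using A_inftyI[OF _ hr c d] by auto
  show "z \<in> closure \<Omega> \<Longrightarrow> D l (restrict h \<Omega>) z = (deriv ^^ l) h z"
    by (rule deriv_ext_eqI[OF c d])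
qed

lemma deriv_ext_diff_bounded:
  assumes "f \<in> A" "g \<in> A"
  shows "bdd_above ((\<lambda>z. cmod (D l f z - D l g z)) ` trunc n)"
proof -
  have "continuous_on (trunc n) (\<lambda>z. cmod (D l f z - D l g z))"
    by (intro continuous_intros continuous_on_trunc assms)
  then show ?thesis
    by (intro bounded_imp_bdd_above compact_imp_bounded compact_continuous_image compact_trunc)
qed

lemma A_infty_dist_alt: "A_infty_dist \<Omega> l n f g = (SUP z\<in>trunc n. cmod (D l f z - D l g z))"
  by (simp add: A_infty_dist_def trunc_def)

lemma A_infty_dist_upper:
  assumes "f \<in> A" "g \<in> A" "z \<in> trunc n"
  shows "cmod (D l f z - D l g z) \<le> A_infty_dist \<Omega> l n f g"
  unfolding A_infty_dist_alt using deriv_ext_diff_bounded[OF assms(1,2)] assms(3) by (intro cSUP_upper)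

lemma A_infty_dist_least:
  assumes "\<And>z. z \<in> trunc n \<Longrightarrow> cmod (D l f z - D l g z) \<le> e"
  shows "A_infty_dist \<Omega> l n f g \<le> e"
  unfolding A_infty_dist_alt using zero_in_trunc assms by (intro cSUP_least) auto

lemma A_infty_dist_nonneg:
  assumes "f \<in> A" "g \<in> A"
  shows "0 \<le> A_infty_dist \<Omega> l n f g"
  using A_infty_dist_upper[OF assms zero_in_trunc] norm_ge_zero order_trans by blast

lemma A_infty_dist_commute: "A_infty_dist \<Omega> l n f g = A_infty_dist \<Omega> l n g f"
  by (simp add: A_infty_dist_def norm_minus_commute)

lemma A_infty_dist_triangle:
  assumes "f \<in> A" "g \<in> A" "h \<in> A"
  shows "A_infty_dist \<Omega> l n f h \<le> A_infty_dist \<Omega> l n f g + A_infty_dist \<Omega> l n g h"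
proof (rule A_infty_dist_least)
  fix z assume z: "z \<in> trunc n"
  have "cmod (D l f z - D l h z) \<le> cmod (D l f z - D l g z) + cmod (D l g z - D l h z)"
    using norm_triangle_ineq[of "D l f z - D l g z" "D l g z - D l h z"] by simp
  then show "cmod (D l f z - D l h z) \<le> A_infty_dist \<Omega> l n f g + A_infty_dist \<Omega> l n g h"
    using A_infty_dist_upper[OF assms(1,2) z, of l] A_infty_dist_upper[OF assms(2,3) z, of l] by linarith
qed

abbreviation mdist_trunc where
  "mdist_trunc f g l n \<equiv> min (A_infty_dist \<Omega> l (Suc n) f g) 1"

lemma A_infty_metric_alt:
  assumes "f \<in> A" "g \<in> A"
  shows "m f g = weighted_sum (mdist_trunc f g)"
  using assms by (simp add: A_infty_metric_def weighted_sum_def)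

lemma mdist_trunc_bounds:
  assumes "f \<in> A" "g \<in> A"
  shows "0 \<le> mdist_trunc f g l n" "mdist_trunc f g l n \<le> 1"
  using A_infty_dist_nonneg[OF assms] by auto

lemma A_infty_dist_zero_imp_eq:
  assumes "f \<in> A" "g \<in> A" "\<And>n. A_infty_dist \<Omega> 0 (Suc n) f g = 0"
  shows "f = g"
proof (rule extensionalityI)
  show "f \<in> extensional \<Omega>" "g \<in> extensional \<Omega>" using assms A_inftyD by auto
  fix z assume z: "z \<in> \<Omega>"
  obtain n where "norm z \<le> real n" using real_arch_simple by blast
  then have "z \<in> trunc (Suc n)" using z closure_subset by (auto simp: trunc_def)
  then have "D 0 f z = D 0 g z"
    using A_infty_dist_upper[OF assms(1,2), of z "Suc n" 0] assms(3)[of n] by simp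
  then show "f z = g z" using A_inftyD(4)[OF assms(1) z, of 0] A_inftyD(4)[OF assms(2) z, of 0] by simp
qed

section \<open>The metric, its convergence and its completeness\<close>

sublocale MS: Metric_space A m
proof
  show "0 \<le> m f g" for f g
    using A_infty_metric_alt weighted_sum_nonneg[OF mdist_trunc_bounds]
    by (cases "f \<in> A \<and> g \<in> A") (auto simp: A_infty_metric_def)
  show "m f g = m g f" for f g
    by (simp add: A_infty_metric_def A_infty_dist_commute conj_commute)
  show "m f g = 0 \<longleftrightarrow> f = g" if fg: "f \<in> A" "g \<in> A" for f g
  proof
    assume m0: "m f g = 0"
    have "(1/2) ^ (0 + Suc n) * mdist_trunc f g 0 n \<le> (1/2) ^ (0 + Suc n) * 0" for n
      using weighted_sum_ge_term[of "mdist_trunc f g" 0 n, OF mdist_trunc_bounds[OF fg]] m0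
      by (simp add: A_infty_metric_alt[OF fg])
    then have "mdist_trunc f g 0 n \<le> 0" for n
      by (rule mult_left_le_imp_le) simp
    then have "A_infty_dist \<Omega> 0 (Suc n) f g \<le> 0" for n
      by (metis min_le_iff_disj not_one_le_zero)
    then have "A_infty_dist \<Omega> 0 (Suc n) f g = 0" for n
      using A_infty_dist_nonneg[OF fg, of 0 "Suc n"] by (simp add: antisym)
    then show "f = g" using A_infty_dist_zero_imp_eq fg by blast
  next
    assume "f = g"
    moreover have "A_infty_dist \<Omega> l n f f = 0" for l n
    proof -
      have "trunc n \<noteq> {}" using zero_in_trunc by blast
      then show ?thesis by (simp add: A_infty_dist_alt)
    qed
    ultimately show "m f g = 0" using fg by (simp add: A_infty_metric_alt weighted_sum_def)
  qed
  show "m f h \<le> m f g + m g h" if "f \<in> A" "g \<in> A" "h \<in> A" for f g h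
  proof -
    have "mdist_trunc f h l n \<le> mdist_trunc f g l n + mdist_trunc g h l n" for l n
      using A_infty_dist_triangle[OF that, of l "Suc n"] A_infty_dist_nonneg[OF that(1,2), of l "Suc n"]
        A_infty_dist_nonneg[OF that(2,3), of l "Suc n"]
      by linarith
    then show ?thesis
      unfolding A_infty_metric_alt[OF that(1,2)] A_infty_metric_alt[OF that(2,3)] A_infty_metric_alt[OF that(1,3)]
      using that by (intro weighted_sum_triangle mdist_trunc_bounds)
  qed
qed

lemma A_infty_topology_eq: "A_infty_topology \<Omega> = MS.mtopology"
  by (simp add: A_infty_topology_def)

lemma dist_le_metric:
  assumes "f \<in> A" "g \<in> A"
  shows "(1/2) ^ (l + Suc n) * min (A_infty_dist \<Omega> l (Suc n) f g) 1 \<le> m f g"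
  using weighted_sum_ge_term[of "mdist_trunc f g" l n, OF mdist_trunc_bounds[OF assms]]
  by (simp add: A_infty_metric_alt[OF assms])

text \<open>A single term bounds the metric from below; the minimum with 1 in the bound guarantees
  that the truncation of the seminorm at 1 is not what makes the term small.\<close>

lemma dist_less_of_metric:
  assumes "f \<in> A" "g \<in> A" "0 < \<epsilon>" "m f g < (1/2) ^ (l + Suc n) * min \<epsilon> 1"
  shows "A_infty_dist \<Omega> l (Suc n) f g < \<epsilon>"
proof -
  have "(1/2) ^ (l + Suc n) * min (A_infty_dist \<Omega> l (Suc n) f g) 1 < (1/2) ^ (l + Suc n) * min \<epsilon> 1"
    using dist_le_metric[OF assms(1,2)] assms(4) by (rule le_less_trans)
  then have "min (A_infty_dist \<Omega> l (Suc n) f g) 1 < min \<epsilon> 1"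
    by (rule mult_left_less_imp_less) simp
  then show ?thesis by auto
qed

lemma uniform_limit_trunc_iff:
  assumes "\<And>i. \<sigma> i \<in> A" "f \<in> A"
  shows "uniform_limit (trunc n) (\<lambda>i. D l (\<sigma> i)) (D l f) G \<longleftrightarrow> ((\<lambda>i. A_infty_dist \<Omega> l n (\<sigma> i) f) \<longlongrightarrow> 0) G"
proof
  assume L: "uniform_limit (trunc n) (\<lambda>i. D l (\<sigma> i)) (D l f) G"
  show "((\<lambda>i. A_infty_dist \<Omega> l n (\<sigma> i) f) \<longlongrightarrow> 0) G"
  proof (rule tendstoI)
    fix e :: real assume e: "e > 0"
    have "\<forall>\<^sub>F i in G. \<forall>z\<in>trunc n. dist (D l (\<sigma> i) z) (D l f z) < e / 2"
      using L e by (intro uniform_limitD) auto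
    then show "\<forall>\<^sub>F i in G. dist (A_infty_dist \<Omega> l n (\<sigma> i) f) 0 < e"
    proof eventually_elim
      case (elim i)
      then have "A_infty_dist \<Omega> l n (\<sigma> i) f \<le> e / 2"
        by (intro A_infty_dist_least) (auto simp: dist_norm intro: less_imp_le)
      then show ?case using A_infty_dist_nonneg[OF assms, of l n i] e by simp
    qed
  qed
next
  assume R: "((\<lambda>i. A_infty_dist \<Omega> l n (\<sigma> i) f) \<longlongrightarrow> 0) G"
  show "uniform_limit (trunc n) (\<lambda>i. D l (\<sigma> i)) (D l f) G"
  proof (rule uniform_limitI)
    fix e :: real assume "e > 0"
    then have "\<forall>\<^sub>F i in G. A_infty_dist \<Omega> l n (\<sigma> i) f < e" using R order_tendstoD(2) by blast
    then show "\<forall>\<^sub>F i in G. \<forall>z\<in>trunc n. dist (D l (\<sigma> i) z) (D l f z) < e"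
      by eventually_elim (auto simp: dist_norm intro: le_less_trans[OF A_infty_dist_upper[OF assms]])
  qed
qed

text \<open>From here on the metric is handled through uniform convergence of every derivative on
  every piece; openness and density arguments below work with limits of functions.\<close>

lemma metric_tendsto_iff:
  assumes "\<And>i. \<sigma> i \<in> A" "f \<in> A" "G \<noteq> bot"
  shows "((\<lambda>i. m (\<sigma> i) f) \<longlongrightarrow> 0) G \<longleftrightarrow>
    (\<forall>l n. uniform_limit (trunc n) (\<lambda>i. D l (\<sigma> i)) (D l f) G)"
proof
  assume L: "((\<lambda>i. m (\<sigma> i) f) \<longlongrightarrow> 0) G"
  show "\<forall>l n. uniform_limit (trunc n) (\<lambda>i. D l (\<sigma> i)) (D l f) G"
  proof (intro allI)
    fix l n
    have "((\<lambda>i. A_infty_dist \<Omega> l (Suc n) (\<sigma> i) f) \<longlongrightarrow> 0) G"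
    proof (rule tendstoI)
      fix e :: real assume e: "e > 0"
      then have "(1/2) ^ (l + Suc n) * min e 1 > 0" by simp
      then have "\<forall>\<^sub>F i in G. m (\<sigma> i) f < (1/2) ^ (l + Suc n) * min e 1" using L order_tendstoD(2) by blast
      then show "\<forall>\<^sub>F i in G. dist (A_infty_dist \<Omega> l (Suc n) (\<sigma> i) f) 0 < e"
      proof eventually_elim
        case (elim i)
        then show ?case
          using dist_less_of_metric[OF assms(1,2) e elim] A_infty_dist_nonneg[OF assms(1,2), of l "Suc n" i] by simp
      qed
    qed
    then have "uniform_limit (trunc (Suc n)) (\<lambda>i. D l (\<sigma> i)) (D l f) G"
      using uniform_limit_trunc_iff[of \<sigma> f, OF assms(1,2)] by blast
    \<comment> \<open>The metric sees only the pieces of index at least 1; index 0 follows because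
      the pieces increase.\<close>
    then show "uniform_limit (trunc n) (\<lambda>i. D l (\<sigma> i)) (D l f) G"
      by (rule uniform_limit_on_subset) (simp add: trunc_mono)
  qed
next
  assume R: "\<forall>l n. uniform_limit (trunc n) (\<lambda>i. D l (\<sigma> i)) (D l f) G"
  have "((\<lambda>i. weighted_sum (mdist_trunc (\<sigma> i) f)) \<longlongrightarrow> 0) G"
  proof (rule weighted_sum_tendsto_0)
    fix l n
    have "((\<lambda>i. A_infty_dist \<Omega> l (Suc n) (\<sigma> i) f) \<longlongrightarrow> 0) G"
      using R uniform_limit_trunc_iff[of \<sigma> f, OF assms(1,2)] by blast
    then show "((\<lambda>i. mdist_trunc (\<sigma> i) f l n) \<longlongrightarrow> 0) G"
      by (rule tendsto_sandwich[OF _ _ tendsto_const, rotated 2])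
        (use A_infty_dist_nonneg[OF assms(1,2)] in \<open>auto intro!: always_eventually\<close>)
  qed (use mdist_trunc_bounds[OF assms(1,2)] assms(3) in blast)+
  then show "((\<lambda>i. m (\<sigma> i) f) \<longlongrightarrow> 0) G" by (simp add: A_infty_metric_alt[OF assms(1,2)])
qed

text \<open>Each extended derivative converges uniformly on every piece, to a function continuous on
  the closure. Inside the domain Weierstrass's theorem identifies these limits as the derivatives of
  the limit of order 0.\<close>

lemma A_infty_complete: "MS.mcomplete"
  unfolding MS.mcomplete_def
proof (intro allI impI)
  fix \<sigma> assume C: "MS.MCauchy \<sigma>"
  then have \<sigma>: "\<sigma> i \<in> A" for i by (auto simp: MS.MCauchy_def)
  define g where "g = (\<lambda>l z. lim (\<lambda>i. D l (\<sigma> i) z))"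
  have ul: "uniform_limit (trunc n) (\<lambda>i. D l (\<sigma> i)) (g l) sequentially" for l n
  proof -
    have "uniformly_Cauchy_on (trunc (Suc n)) (\<lambda>i. D l (\<sigma> i))"
      unfolding uniformly_Cauchy_on_def
    proof (intro allI impI)
      fix e :: real assume e: "e > 0"
      then have "(1/2) ^ (l + Suc n) * min e 1 > 0" by simp
      then obtain N where N: "\<And>i j. N \<le> i \<Longrightarrow> N \<le> j \<Longrightarrow> m (\<sigma> i) (\<sigma> j) < (1/2) ^ (l + Suc n) * min e 1"
        using C unfolding MS.MCauchy_def by blast
      have "dist (D l (\<sigma> i) z) (D l (\<sigma> j) z) < e" if "z \<in> trunc (Suc n)" "N \<le> i" "N \<le> j" for z i j
        unfolding dist_norm
        using A_infty_dist_upper[OF \<sigma> \<sigma> that(1)] dist_less_of_metric[OF \<sigma> \<sigma> e N[OF that(2,3)]]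
        by (rule le_less_trans)
      then show "\<exists>M. \<forall>x\<in>trunc (Suc n). \<forall>i\<ge>M. \<forall>j\<ge>M. dist (D l (\<sigma> i) x) (D l (\<sigma> j) x) < e" by blast
    qed
    then have "uniform_limit (trunc (Suc n)) (\<lambda>i. D l (\<sigma> i)) (g l) sequentially"
      unfolding g_def by (simp add: Cauchy_uniformly_convergent uniformly_convergent_uniform_limit_iff[symmetric])
    then show ?thesis by (rule uniform_limit_on_subset) (simp add: trunc_mono)
  qed
  have cg: "continuous_on (closure \<Omega>) (g l)" for l
    unfolding continuous_on_eq_continuous_within
  proof
    fix z assume z: "z \<in> closure \<Omega>"
    obtain n where n: "norm z < real n" using reals_Archimedean2 by blast
    have "continuous_on (trunc n) (g l)"
      by (intro uniform_limit_theorem[OF _ ul] always_eventually allI continuous_on_trunc \<sigma>) simp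
    then have "continuous (at z within trunc n) (g l)"
      using z n by (auto simp: continuous_on_eq_continuous_within trunc_def)
    \<comment> \<open>Since |z| < n strictly, the piece and the closure agree near z, so continuity
      on pieces is continuity on the closure.\<close>
    moreover have "at z within trunc n = at z within closure \<Omega>"
      using n by (intro at_within_nhd[of _ "ball 0 n"]) (auto simp: trunc_def)
    ultimately show "continuous (at z within closure \<Omega>) (g l)" by simp
  qed
  have loc: "\<exists>r>0. cball z r \<subseteq> \<Omega> \<and> uniform_limit (cball z r) \<sigma> (g 0) sequentially" if z: "z \<in> \<Omega>" for z
  proof -
    obtain r where r: "r > 0" "cball z r \<subseteq> \<Omega>" using open_domain z open_contains_cball by blast
    obtain n where n: "norm z + r \<le> real n" using real_arch_simple by blast
    have "cball z r \<subseteq> trunc n"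
    proof
      fix w assume w: "w \<in> cball z r"
      then have "norm w \<le> norm z + r" using norm_triangle_sub[of w z] by (simp add: dist_norm norm_minus_commute)
      moreover have "w \<in> closure \<Omega>" using w r closure_subset by blast
      ultimately show "w \<in> trunc n" using n by (simp add: trunc_def)
    qed
    then have "uniform_limit (cball z r) (\<lambda>i. D 0 (\<sigma> i)) (g 0) sequentially"
      using ul uniform_limit_on_subset by blast
    moreover have "D 0 (\<sigma> i) w = \<sigma> i w" if "w \<in> cball z r" for i w
      using A_inftyD(4)[OF \<sigma>, of w 0] r that by auto
    ultimately have "uniform_limit (cball z r) \<sigma> (g 0) sequentially"
      using uniform_limit_cong'[of "cball z r" "\<lambda>i. D 0 (\<sigma> i)" \<sigma> "g 0" "g 0" sequentially] by simp
    then show ?thesis using r by blast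
  qed
  have hol: "g 0 holomorphic_on \<Omega>"
    by (rule holomorphic_uniform_sequence[OF open_domain A_inftyD(2)[OF \<sigma>] loc])
  have dg: "g l z = (deriv ^^ l) (g 0) z" if z: "z \<in> \<Omega>" for l z
  proof -
    obtain r where r: "r > 0" "cball z r \<subseteq> \<Omega>" "uniform_limit (cball z r) \<sigma> (g 0) sequentially"
      using loc[OF z] by blast
    have "(\<lambda>i. (deriv ^^ l) (\<sigma> i) z) \<longlonglongrightarrow> (deriv ^^ l) (g 0) z"
    proof (rule higher_deriv_complex_uniform_limit)
      show "uniform_limit (ball z r) \<sigma> (g 0) sequentially"
        using r(3) by (rule uniform_limit_on_subset) auto
      have "ball z r \<subseteq> \<Omega>" using r(2) by auto
      then show "\<forall>\<^sub>F i in sequentially. \<sigma> i holomorphic_on ball z r"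
        using A_inftyD(2)[OF \<sigma>] holomorphic_on_subset by (intro always_eventually) blast
    qed (use r in auto)
    moreover have "(\<lambda>i. D l (\<sigma> i) z) \<longlonglongrightarrow> g l z"
    proof -
      obtain n where "norm z \<le> real n" using real_arch_simple by blast
      then have "z \<in> trunc n" using z closure_subset by (auto simp: trunc_def)
      then show ?thesis by (rule tendsto_uniform_limitI[OF ul])
    qed
    ultimately show ?thesis using A_inftyD(4)[OF \<sigma> z] LIMSEQ_unique by simp
  qed
  define f where "f = restrict (g 0) \<Omega>"
  have holf: "f holomorphic_on \<Omega>" using hol by (auto simp: f_def cong: holomorphic_cong)
  have df: "g l z = (deriv ^^ l) f z" if "z \<in> \<Omega>" for l z
    using dg[OF that] higher_deriv_transform_within_open[OF hol holf open_domain that, of l] by (simp add: f_def)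
  have f: "f \<in> A" using A_inftyI[OF _ holf cg df] by (simp add: f_def)
  have "uniform_limit (trunc n) (\<lambda>i. D l (\<sigma> i)) (D l f) sequentially" for l n
  proof -
    have "D l f z = g l z" if "z \<in> trunc n" for z
      using deriv_ext_eqI[OF cg df] that trunc_subset by blast
    then show ?thesis using ul[of l n] uniform_limit_cong'[of "trunc n" "\<lambda>i. D l (\<sigma> i)" "\<lambda>i. D l (\<sigma> i)" "D l f" "g l"] by simp
  qed
  then have "(\<lambda>i. m (\<sigma> i) f) \<longlonglongrightarrow> 0" using metric_tendsto_iff[of \<sigma> f, OF \<sigma> f] by simp
  then have "limitin MS.mtopology \<sigma> f sequentially"
    using f \<sigma> by (simp add: MS.limitin_metric_dist_null)
  then show "\<exists>x. limitin MS.mtopology \<sigma> x sequentially" by blast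
qed

end

section \<open>Openness, density and Baire category\<close>

text \<open>Cauchy's estimate on discs of one common radius around all points of \<open>K\<close>,
  boundary points included; this is why convergence on a neighbourhood is assumed.\<close>

lemma uniform_limit_higher_deriv:
  fixes f :: "'b \<Rightarrow> complex \<Rightarrow> complex"
  assumes "e > 0"
    and lim: "uniform_limit {z. infdist z K < e} f g G"
    and hf: "\<forall>\<^sub>F i in G. f i holomorphic_on {z. infdist z K < e}"
    and hg: "g holomorphic_on {z. infdist z K < e}"
  shows "uniform_limit K (\<lambda>i. (deriv ^^ l) (f i)) ((deriv ^^ l) g) G"
proof (rule uniform_limitI)
  fix \<epsilon> :: real assume \<epsilon>: "\<epsilon> > 0"
  let ?U = "{z. infdist z K < e}"
  have opU: "open ?U" by (intro open_Collect_less continuous_intros)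
  define \<delta> where "\<delta> = e / 2"
  \<comment> \<open>Chosen so that Cauchy's bound, fact l * B / \<delta>^l, equals \<epsilon> /
    2.\<close>
  define B where "B = \<epsilon> * \<delta> ^ l / (2 * fact l)"
  have \<delta>: "\<delta> > 0" using assms(1) by (simp add: \<delta>_def)
  have B: "B > 0" using \<epsilon> \<delta> by (simp add: B_def)
  have "\<forall>\<^sub>F i in G. \<forall>z\<in>?U. dist (f i z) (g z) < B" using uniform_limitD[OF lim B] .
  then show "\<forall>\<^sub>F i in G. \<forall>z\<in>K. dist ((deriv ^^ l) (f i) z) ((deriv ^^ l) g z) < \<epsilon>"
    using hf
  proof eventually_elim
    case (elim i)
    show ?case
    proof
      fix z assume z: "z \<in> K"
      have sub: "cball z \<delta> \<subseteq> ?U"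
      proof
        fix w assume "w \<in> cball z \<delta>"
        then have "dist w z \<le> \<delta>" by (simp add: dist_commute)
        then show "w \<in> ?U" using infdist_le[OF z, of w] assms(1) by (simp add: \<delta>_def)
      qed
      moreover have "z \<in> cball z \<delta>" using \<delta> by simp
      ultimately have zU: "z \<in> ?U" by blast
      have hd: "(\<lambda>w. f i w - g w) holomorphic_on ?U" using elim(2) hg by (intro holomorphic_intros)
      have "cmod ((deriv ^^ l) (\<lambda>w. f i w - g w) z) \<le> fact l * B / \<delta> ^ l"
      \<comment> \<open>Cauchy's estimate is available for positive orders; order 0 is the assumed
        uniform closeness.\<close>
      proof (cases "l = 0")
        case True
        then show ?thesis using elim(1) zU by (auto simp: dist_norm intro: less_imp_le)
      next
        case False
        show ?thesis
        proof (rule Cauchy_higher_deriv_bound[where y = 0])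
          show "(\<lambda>w. f i w - g w) holomorphic_on ball z \<delta>"
            using hd sub ball_subset_cball holomorphic_on_subset by blast
          show "continuous_on (cball z \<delta>) (\<lambda>w. f i w - g w)"
            using hd sub continuous_on_subset holomorphic_on_imp_continuous_on by blast
          show "f i w - g w \<in> ball 0 B" if "w \<in> ball z \<delta>" for w
          proof -
            have "w \<in> cball z \<delta>" using that by simp
            then have "w \<in> ?U" using sub by blast
            then show ?thesis using elim(1) by (auto simp: dist_norm norm_minus_commute)
          qed
        qed (use \<delta> False in auto)
      qed
      also have "\<dots> = \<epsilon> / 2" using \<delta> by (simp add: B_def)
      also have "\<dots> < \<epsilon>" using \<epsilon> by simp
      finally show "dist ((deriv ^^ l) (f i) z) ((deriv ^^ l) g z) < \<epsilon>"
        using higher_deriv_diff[OF elim(2) hg opU zU, of l] by (simp add: dist_norm)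
    qed
  qed
qed

lemma uniform_limit_poly:
  fixes P :: "'b \<Rightarrow> complex poly"
  assumes "\<And>i. degree (P i) \<le> n" "degree Q \<le> n"
    and lim: "\<And>v. ((\<lambda>i. poly.coeff (P i) v) \<longlongrightarrow> poly.coeff Q v) G" and "bounded L"
  shows "uniform_limit L (\<lambda>i. poly (P i)) (poly Q) G"
proof -
  have alt: "poly p z = (\<Sum>v\<le>n. poly.coeff p v * z ^ v)" if "degree p \<le> n" for p :: "complex poly" and z
  proof -
    have "(\<Sum>v\<le>degree p. poly.coeff p v * z ^ v) = (\<Sum>v\<le>n. poly.coeff p v * z ^ v)"
      using that by (intro sum.mono_neutral_left) (auto simp: coeff_eq_0)
    then show ?thesis by (simp add: poly_altdef)
  qed
  have bdd: "bounded ((\<lambda>z. z ^ v) ` L)" for v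
  proof -
    have "bounded ((\<lambda>z. z ^ v) ` closure L)"
      using assms(4) by (intro compact_imp_bounded compact_continuous_image continuous_intros) auto
    then show ?thesis by (rule bounded_subset) (use closure_subset in blast)
  qed
  have summand: "uniform_limit L (\<lambda>i z. poly.coeff (P i) v * z ^ v) (\<lambda>z. poly.coeff Q v * z ^ v) G" for v
  proof (intro uniform_lim_mult bdd uniform_limit_const)
    show "uniform_limit L (\<lambda>i z. poly.coeff (P i) v) (\<lambda>z. poly.coeff Q v) G"
      using lim[of v] by (auto simp: uniform_limit_iff tendsto_iff elim: eventually_mono)
    show "bounded ((\<lambda>z. poly.coeff Q v) ` L)" by (rule bounded_subset[of "{poly.coeff Q v}"]) auto
  qed
  have "uniform_limit L (\<lambda>i z. \<Sum>v\<le>n. poly.coeff (P i) v * z ^ v) (\<lambda>z. \<Sum>v\<le>n. poly.coeff Q v * z ^ v) G"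
  proof (induction n)
    case 0
    show ?case using summand[of 0] by simp
  next
    case (Suc n)
    then show ?case using uniform_limit_add[OF Suc summand[of "Suc n"]] by simp
  qed
  then show ?thesis unfolding alt[OF assms(1)] alt[OF assms(2)] .
qed

lemma rational_holomorphic:
  fixes P Q :: "complex poly"
  assumes "\<And>z. z \<in> S \<Longrightarrow> poly Q z \<noteq> 0"
  shows "(\<lambda>z. poly P z / poly Q z) holomorphic_on S"
  using assms by (intro holomorphic_on_divide poly_holomorphic_on holomorphic_on_ident)

section \<open>Functions with a close Pade approximant, and openness of these sets\<close>

context A_infty_domain
begin

text \<open>The bound e below 1 / (s + 1) makes the inequality strict uniformly in the point and the
  order; this slack is what a perturbation uses up.\<close>

definition pade_close :: "nat \<Rightarrow> nat \<Rightarrow> nat \<Rightarrow> (complex \<Rightarrow> complex) \<Rightarrow> bool" where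
  "pade_close s p q f \<longleftrightarrow> pade_regular f p q \<and> trunc s \<inter> rat_poles (pade f p q) = {} \<and>
     (\<exists>e<1 / Suc s. \<forall>l\<le>s. \<forall>z\<in>trunc s. cmod ((deriv ^^ l) (rat_eval (pade f p q)) z - D l f z) \<le> e)"

text \<open>Up to a factorial a Taylor coefficient is the value of an extended derivative at 0, a
  point of every piece, so it depends continuously on f.\<close>

lemma fps_nth_fps_expansion_eq_deriv_ext:
  assumes "f \<in> A"
  shows "fps_nth (fps_expansion f 0) v = D v f 0 / fact v"
  using A_inftyD(4)[OF assms zero_in_domain] by (simp add: fps_expansion_def)

text \<open>Convergence of the Taylor coefficients gives convergence of numerators and denominators
  on a neighbourhood of the piece where the limit denominator has no zero. There the quotients
  converge, and Cauchy's estimates add their derivatives.\<close>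

lemma pade_close_eventually:
  assumes f: "f \<in> A" and \<sigma>: "\<And>i. \<sigma> i \<in> A" and close: "pade_close s p q f"
    and lim: "\<And>l n. uniform_limit (trunc n) (\<lambda>i. D l (\<sigma> i)) (D l f) G"
  shows "\<forall>\<^sub>F i in G. pade_close s p q (\<sigma> i)"
proof -
  define F where "F = fps_expansion f 0"
  define F' where "F' = (\<lambda>i. fps_expansion (\<sigma> i) 0)"
  have coef: "((\<lambda>i. fps_nth (F' i) v) \<longlongrightarrow> fps_nth F v) G" for v
    unfolding F_def F'_def fps_nth_fps_expansion_eq_deriv_ext[OF f] fps_nth_fps_expansion_eq_deriv_ext[OF \<sigma>]
    by (intro tendsto_intros tendsto_uniform_limitI[OF lim zero_in_trunc]) auto
  have reg: "pade_regular f p q" using close by (simp add: pade_close_def)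
  then have det: "Determinant.det (hankel F p q) \<noteq> 0" by (simp add: pade_regular_iff F_def)
  let ?N = "pade_num F p q" and ?D = "pade_den F p q"
  let ?N' = "\<lambda>i. pade_num (F' i) p q" and ?D' = "\<lambda>i. pade_den (F' i) p q"
  note pd = pade_regular_pade[OF reg, folded F_def]
  obtain e where e: "e < 1 / Suc s"
    "\<And>l z. l \<le> s \<Longrightarrow> z \<in> trunc s \<Longrightarrow> cmod ((deriv ^^ l) (rat_eval (pade f p q)) z - D l f z) \<le> e"
    using close unfolding pade_close_def by blast
  have ne: "trunc s \<noteq> {}" using zero_in_trunc by blast
  have "trunc s \<subseteq> {z. poly ?D z \<noteq> 0}"
    using close by (auto simp: pade_close_def pd(2))
  moreover have "open {z. poly ?D z \<noteq> 0}"
    by (intro open_Collect_neq continuous_intros)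
  ultimately obtain r where r: "r > 0" "{x. infdist x (trunc s) \<le> r} \<subseteq> {z. poly ?D z \<noteq> 0}"
    using compact_in_open_separated[OF ne compact_trunc] by metis
  \<comment> \<open>\<open>L\<close> is compact, which gives a lower bound for the denominator;
    \<open>U\<close> is its open companion, on which the quotients are holomorphic.\<close>
  define L where "L = {x. infdist x (trunc s) \<le> r}"
  define U where "U = {x. infdist x (trunc s) < r}"
  have UL: "U \<subseteq> L" by (auto simp: U_def L_def)
  have KU: "trunc s \<subseteq> U" using r(1) by (auto simp: U_def)
  have cL: "compact L" unfolding L_def using r(1) compact_trunc ne by (intro compact_infdist_le) auto
  have limN: "uniform_limit L (\<lambda>i. poly (?N' i)) (poly ?N) G"
    by (intro uniform_limit_poly[OF degree_pade_num degree_pade_num] tendsto_coeff_pade coef det compact_imp_bounded cL)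
  have limD: "uniform_limit L (\<lambda>i. poly (?D' i)) (poly ?D) G"
    by (intro uniform_limit_poly[OF degree_pade_den degree_pade_den] tendsto_coeff_pade coef det compact_imp_bounded cL)
  obtain b where b: "b > 0" "\<And>z. z \<in> L \<Longrightarrow> b \<le> cmod (poly ?D z)"
  proof -
    have "L \<noteq> {}" using KU UL ne by blast
    moreover have "continuous_on L (\<lambda>z. cmod (poly ?D z))" by (intro continuous_intros)
    ultimately obtain z0 where z0: "z0 \<in> L" "\<And>z. z \<in> L \<Longrightarrow> cmod (poly ?D z0) \<le> cmod (poly ?D z)"
      using continuous_attains_inf[OF cL] by blast
    then have "poly ?D z0 \<noteq> 0" using r(2) by (auto simp: L_def)
    then show ?thesis using that[of "cmod (poly ?D z0)"] z0 by simp
  qed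
  have evD: "\<forall>\<^sub>F i in G. \<forall>z\<in>L. poly (?D' i) z \<noteq> 0"
    using uniform_limitD[OF limD b(1)]
  proof eventually_elim
    case (elim i)
    show ?case
    proof
      fix z assume z: "z \<in> L"
      show "poly (?D' i) z \<noteq> 0" using elim[rule_format, OF z] b(2)[OF z] by auto
    qed
  qed
  have evreg: "\<forall>\<^sub>F i in G. pade_regular (\<sigma> i) p q"
  proof -
    have "((\<lambda>i. Determinant.det (hankel (F' i) p q)) \<longlongrightarrow> Determinant.det (hankel F p q)) G"
      by (rule tendsto_hankel(1)[OF coef])
    then show ?thesis using tendsto_imp_eventually_ne[OF _ det] by (simp add: pade_regular_iff F'_def)
  qed
  have bddN: "bounded (poly ?N ` L)"
    by (intro compact_imp_bounded compact_continuous_image continuous_intros cL)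
  have "uniform_limit L (\<lambda>i z. poly (?N' i) z / poly (?D' i) z) (\<lambda>z. poly ?N z / poly ?D z) G"
    by (rule uniform_lim_divide[OF limN limD bddN b(2) b(1)])
  then have limU: "uniform_limit U (\<lambda>i z. poly (?N' i) z / poly (?D' i) z) (\<lambda>z. poly ?N z / poly ?D z) G"
    using UL by (rule uniform_limit_on_subset)
  have limd: "uniform_limit (trunc s) (\<lambda>i. (deriv ^^ l) (\<lambda>z. poly (?N' i) z / poly (?D' i) z))
      ((deriv ^^ l) (\<lambda>z. poly ?N z / poly ?D z)) G" for l
  proof (rule uniform_limit_higher_deriv[OF r(1)])
    show "uniform_limit {z. infdist z (trunc s) < r} (\<lambda>i z. poly (?N' i) z / poly (?D' i) z) (\<lambda>z. poly ?N z / poly ?D z) G"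
      using limU by (simp add: U_def)
    show "\<forall>\<^sub>F i in G. (\<lambda>z. poly (?N' i) z / poly (?D' i) z) holomorphic_on {z. infdist z (trunc s) < r}"
      using evD by eventually_elim (rule rational_holomorphic, use UL in \<open>auto simp: U_def[symmetric]\<close>)
    show "(\<lambda>z. poly ?N z / poly ?D z) holomorphic_on {z. infdist z (trunc s) < r}"
    proof (rule rational_holomorphic)
      fix z assume "z \<in> {z. infdist z (trunc s) < r}"
      then have "z \<in> L" by (simp add: L_def)
      then show "poly ?D z \<noteq> 0" using b(1) b(2)[of z] by auto
    qed
  qed
  \<comment> \<open>The approximant and the function each move by less than \<eta>, a quarter of the
    slack, so the new bound e + 2 * \<eta> uses half of it.\<close>
  define \<eta> where "\<eta> = (1 / Suc s - e) / 4"
  have \<eta>: "\<eta> > 0" using e(1) by (simp add: \<eta>_def)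
  have ev: "\<forall>\<^sub>F i in G. \<forall>l\<in>{..s}. \<forall>z\<in>trunc s.
      dist ((deriv ^^ l) (\<lambda>z. poly (?N' i) z / poly (?D' i) z) z) ((deriv ^^ l) (\<lambda>z. poly ?N z / poly ?D z) z) < \<eta> \<and>
      dist (D l (\<sigma> i) z) (D l f z) < \<eta>"
  proof (rule eventually_ball_finite, simp, rule ballI)
    fix l assume "l \<in> {..s}"
    show "\<forall>\<^sub>F i in G. \<forall>z\<in>trunc s.
      dist ((deriv ^^ l) (\<lambda>z. poly (?N' i) z / poly (?D' i) z) z) ((deriv ^^ l) (\<lambda>z. poly ?N z / poly ?D z) z) < \<eta> \<and>
      dist (D l (\<sigma> i) z) (D l f z) < \<eta>"
      using uniform_limitD[OF limd \<eta>, of l] uniform_limitD[OF lim \<eta>, of s l] by eventually_elim blast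
  qed
  show ?thesis
    using evreg evD ev
  proof eventually_elim
    case (elim i)
    note pi = pade_regular_pade[OF elim(1), folded F'_def]
    have "trunc s \<inter> rat_poles (pade (\<sigma> i) p q) = {}"
      using elim(2) KU UL unfolding pi(2) F'_def by blast
    moreover have "cmod ((deriv ^^ l) (rat_eval (pade (\<sigma> i) p q)) z - D l (\<sigma> i) z) \<le> e + 2 * \<eta>"
      if "l \<le> s" "z \<in> trunc s" for l z
    proof -
      have 1: "cmod ((deriv ^^ l) (rat_eval (pade (\<sigma> i) p q)) z - (deriv ^^ l) (rat_eval (pade f p q)) z) < \<eta>"
        "cmod (D l f z - D l (\<sigma> i) z) < \<eta>"
        using elim(3) that unfolding pi(1) pd(1) F'_def by (auto simp: dist_norm norm_minus_commute)
      then show ?thesis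
        using e(2)[OF that] norm_triangle_ineq[of "(deriv ^^ l) (rat_eval (pade (\<sigma> i) p q)) z - (deriv ^^ l) (rat_eval (pade f p q)) z"
            "(deriv ^^ l) (rat_eval (pade f p q)) z - D l (\<sigma> i) z"]
          norm_triangle_ineq[of "(deriv ^^ l) (rat_eval (pade f p q)) z - D l f z" "D l f z - D l (\<sigma> i) z"]
        by simp
    qed
    moreover have "e + 2 * ((c - e) / 4) < c" if "e < c" for c :: real using that by (simp add: field_simps)
    then have "e + 2 * \<eta> < 1 / Suc s" unfolding \<eta>_def using e(1) by blast
    ultimately show ?case using elim(1) unfolding pade_close_def by blast
  qed
qed

definition pade_close_set :: "(nat \<times> nat) set \<Rightarrow> nat \<Rightarrow> (complex \<Rightarrow> complex) set" where
  "pade_close_set F s = {f \<in> A. \<exists>(p, q)\<in>F. pade_close s p q f}"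

text \<open>Openness is reduced to sequences: if no ball fitted, points in balls of radius 1 / (i +
  1) outside the set would converge to f, against \<open>pade_close_eventually\<close>.\<close>

lemma openin_pade_close_set: "openin MS.mtopology (pade_close_set F s)"
  unfolding MS.openin_mtopology
proof (intro conjI ballI allI impI)
  show "pade_close_set F s \<subseteq> A" by (auto simp: pade_close_set_def)
  fix f assume "f \<in> pade_close_set F s"
  then obtain p q where f: "f \<in> A" and pq: "(p, q) \<in> F" "pade_close s p q f"
    by (auto simp: pade_close_set_def)
  show "\<exists>r>0. MS.mball f r \<subseteq> pade_close_set F s"
  proof (rule ccontr)
    assume "\<not> ?thesis"
    then have "\<exists>g. g \<in> MS.mball f (1 / Suc i) \<and> g \<notin> pade_close_set F s" for i :: nat
      by (metis of_nat_0_less_iff subsetI zero_less_Suc zero_less_divide_1_iff)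
    then obtain \<sigma> where \<sigma>: "\<And>i. \<sigma> i \<in> MS.mball f (1 / Suc i)" "\<And>i. \<sigma> i \<notin> pade_close_set F s" by metis
    have \<sigma>A: "\<sigma> i \<in> A" for i using \<sigma>(1)[of i] by simp
    have "(\<lambda>i. m (\<sigma> i) f) \<longlonglongrightarrow> 0"
    proof (rule Lim_null_comparison[OF always_eventually LIMSEQ_Suc[OF lim_1_over_n]], rule allI)
      fix i show "norm (m (\<sigma> i) f) \<le> 1 / real (Suc i)"
        using \<sigma>(1)[of i] MS.commute[of f "\<sigma> i"] by simp
    qed
    then have "\<forall>\<^sub>F i in sequentially. pade_close s p q (\<sigma> i)"
      using metric_tendsto_iff[of \<sigma> f sequentially, OF \<sigma>A f] by (intro pade_close_eventually[OF f \<sigma>A pq(2)]) simp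
    then obtain i where "pade_close s p q (\<sigma> i)" using eventually_happens' sequentially_bot by blast
    then show False using \<sigma>(2)[of i] \<sigma>A pq(1) by (auto simp: pade_close_set_def)
  qed
qed

lemma compact_subset_trunc:
  assumes "compact K" "K \<subseteq> closure \<Omega>"
  obtains N where "K \<subseteq> trunc N"
proof -
  obtain M where "\<And>z. z \<in> K \<Longrightarrow> norm z \<le> M" using compact_imp_bounded[OF assms(1)] bounded_iff by blast
  moreover obtain N where "M \<le> real N" using real_arch_simple by blast
  ultimately show ?thesis using that[of N] assms(2) by (force simp: trunc_def)
qed

text \<open>A diagonal choice: pick the k-th pair for the k-th condition. Given \<open>K\<close> and
  l, all conditions with k large control \<open>K\<close> and order l, with error below 1 / (k +
  1).\<close>

lemma pade_convergent_eq: "pade_convergent \<Omega> F = (\<Inter>s. pade_close_set F s)"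
proof (intro equalityI subsetI)
  fix f assume "f \<in> pade_convergent \<Omega> F"
  then obtain p q where f: "f \<in> A"
    and pq0: "\<forall>k. (p k, q k) \<in> F \<and> pade_regular f (p k) (q k)"
    and con0: "\<forall>K l. compact K \<and> K \<subseteq> closure \<Omega> \<longrightarrow> (\<forall>\<^sub>F k in sequentially. K \<inter> rat_poles (pade f (p k) (q k)) = {}) \<and>
        uniform_limit K (\<lambda>k. (deriv ^^ l) (rat_eval (pade f (p k) (q k)))) (D l f) sequentially"
    unfolding pade_convergent_def mem_Collect_eq by (elim conjE exE) (rule that)
  have pq: "\<And>k. (p k, q k) \<in> F" "\<And>k. pade_regular f (p k) (q k)" using pq0 by auto
  note con = con0[rule_format, OF conjI]
  have "f \<in> pade_close_set F s" for s
  proof -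
    \<comment> \<open>Half of 1 / (s + 1) serves as the bound e, which has to be strictly smaller
      than 1 / (s + 1).\<close>
    have 0: "1 / (2 * real (Suc s)) > 0" by simp
    have "\<forall>\<^sub>F k in sequentially. \<forall>l\<in>{..s}. \<forall>z\<in>trunc s.
        dist ((deriv ^^ l) (rat_eval (pade f (p k) (q k))) z) (D l f z) < 1 / (2 * real (Suc s))"
      using uniform_limitD[OF conjunct2[OF con[OF compact_trunc trunc_subset]] 0]
      by (intro eventually_ball_finite[OF finite_atMost] ballI[of "{..s}"])
    moreover have "\<forall>\<^sub>F k in sequentially. trunc s \<inter> rat_poles (pade f (p k) (q k)) = {}"
      using con[OF compact_trunc trunc_subset] by blast
    ultimately have "\<forall>\<^sub>F k in sequentially. pade_close s (p k) (q k) f"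
    proof eventually_elim
      case (elim k)
      show ?case
        unfolding pade_close_def using pq elim
        by (intro conjI exI[of _ "1 / (2 * real (Suc s))"]) (auto simp: dist_norm frac_less2 intro: less_imp_le)
    qed
    then obtain k where "pade_close s (p k) (q k) f" using eventually_happens' sequentially_bot by blast
    then show ?thesis using f pq(1)[of k] unfolding pade_close_set_def by blast
  qed
  then show "f \<in> (\<Inter>s. pade_close_set F s)" by blast
next
  fix f assume "f \<in> (\<Inter>s. pade_close_set F s)"
  then have f: "f \<in> A" and "\<forall>s. \<exists>pq. pq \<in> F \<and> pade_close s (fst pq) (snd pq) f"
    by (auto simp: pade_close_set_def) force
  then obtain pq where pq: "\<And>s. pq s \<in> F" "\<And>s. pade_close s (fst (pq s)) (snd (pq s)) f" by metis
  have con: "(\<forall>\<^sub>F k in sequentially. K \<inter> rat_poles (pade f (fst (pq k)) (snd (pq k))) = {}) \<and>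
     uniform_limit K (\<lambda>k. (deriv ^^ l) (rat_eval (pade f (fst (pq k)) (snd (pq k))))) (D l f) sequentially"
    if K: "compact K" "K \<subseteq> closure \<Omega>" for K l
  proof
    obtain N where N: "K \<subseteq> trunc N" using compact_subset_trunc[OF K] .
    have KN: "K \<subseteq> trunc k" if "N \<le> k" for k using N trunc_mono[OF that] by blast
    show "\<forall>\<^sub>F k in sequentially. K \<inter> rat_poles (pade f (fst (pq k)) (snd (pq k))) = {}"
      using eventually_ge_at_top[of N]
    proof eventually_elim
      case (elim k)
      then show ?case using KN pq(2)[of k] unfolding pade_close_def by blast
    qed
    show "uniform_limit K (\<lambda>k. (deriv ^^ l) (rat_eval (pade f (fst (pq k)) (snd (pq k))))) (D l f) sequentially"
    proof (rule uniform_limitI)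
      fix \<epsilon> :: real assume "\<epsilon> > 0"
      then have "\<forall>\<^sub>F k in sequentially. 1 / real (Suc k) < \<epsilon>"
        using LIMSEQ_Suc[OF lim_1_over_n] order_tendstoD(2) by blast
      then show "\<forall>\<^sub>F k in sequentially. \<forall>z\<in>K. dist ((deriv ^^ l) (rat_eval (pade f (fst (pq k)) (snd (pq k)))) z) (D l f z) < \<epsilon>"
        using eventually_ge_at_top[of "max N l"]
      proof eventually_elim
        case (elim k)
        obtain e where "e < 1 / Suc k" "\<forall>l\<le>k. \<forall>z\<in>trunc k.
            cmod ((deriv ^^ l) (rat_eval (pade f (fst (pq k)) (snd (pq k)))) z - D l f z) \<le> e"
          using pq(2)[of k] unfolding pade_close_def by blast
        then show ?case using elim KN[of k] by (force simp: dist_norm)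
      qed
    qed
  qed
  have "\<forall>k. (fst (pq k), snd (pq k)) \<in> F \<and> pade_regular f (fst (pq k)) (snd (pq k))"
    using pq by (simp add: pade_close_def)
  moreover have "\<forall>K l. compact K \<and> K \<subseteq> closure \<Omega> \<longrightarrow>
     (\<forall>\<^sub>F k in sequentially. K \<inter> rat_poles (pade f (fst (pq k)) (snd (pq k))) = {}) \<and>
     uniform_limit K (\<lambda>k. (deriv ^^ l) (rat_eval (pade f (fst (pq k)) (snd (pq k))))) (D l f) sequentially"
    by (intro allI impI con) (elim conjE; assumption)+
  ultimately show "f \<in> pade_convergent \<Omega> F"
    unfolding pade_convergent_def
    by (intro CollectI conjI[OF f] exI[of _ "\<lambda>k. fst (pq k)"] exI[of _ "\<lambda>k. snd (pq k)"]) (rule conjI)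
qed

section \<open>Density of the polynomials and of the functions with close approximants\<close>

lemma closure_of_sequentialI:
  assumes "\<And>i. \<sigma> i \<in> S" "\<And>i. \<sigma> i \<in> A" "f \<in> A"
    "\<And>l n. uniform_limit (trunc n) (\<lambda>i. D l (\<sigma> i)) (D l f) sequentially"
  shows "f \<in> MS.mtopology closure_of S"
  unfolding MS.metric_closure_of
proof (intro CollectI conjI allI impI assms(3))
  fix r :: real assume "r > 0"
  have "(\<lambda>i. m (\<sigma> i) f) \<longlonglongrightarrow> 0"
    using metric_tendsto_iff[of \<sigma> f sequentially, OF assms(2,3)] assms(4) by simp
  then have "\<forall>\<^sub>F i in sequentially. m (\<sigma> i) f < r" using \<open>r > 0\<close> order_tendstoD(2) by blast
  then obtain i where "m (\<sigma> i) f < r" using eventually_happens' sequentially_bot by blast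
  then show "\<exists>y\<in>S. y \<in> MS.mball f r"
    using assms(1)[of i] assms(2)[of i] assms(3) by (intro bexI[of _ "\<sigma> i"]) (auto simp: MS.commute)
qed

abbreviation poly_fun :: "complex poly \<Rightarrow> complex \<Rightarrow> complex" where
  "poly_fun P \<equiv> restrict (poly P) \<Omega>"

lemma poly_holomorphic: "poly P holomorphic_on S" for P :: "complex poly"
  using poly_holomorphic_on[OF holomorphic_on_ident] by simp

lemma poly_fun:
  shows "poly_fun P \<in> A" "z \<in> closure \<Omega> \<Longrightarrow> D l (poly_fun P) z = (deriv ^^ l) (poly P) z"
  using restrict_holomorphic[OF open_UNIV subset_UNIV poly_holomorphic] by auto

lemma poly_fun_in_H_closure: "poly_fun P \<in> H_closure \<Omega>"
  unfolding H_closure_def using poly_holomorphic by (blast intro: open_UNIV)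

lemma fps_expansion_poly_fun: "fps_expansion (poly_fun P) 0 = fps_of_poly P"
proof (rule fps_expansion_eqI)
  have "\<forall>\<^sub>F x in nhds 0. x \<in> \<Omega>" using open_domain zero_in_domain by (rule eventually_nhds_in_open)
  then have "\<forall>\<^sub>F x in nhds 0. poly_fun P x = poly P x" by eventually_elim simp
  then show "poly_fun P has_fps_expansion fps_of_poly P"
    using has_fps_expansion_poly[of P] has_fps_expansion_cong by blast
qed

lemma poly_fun_uniform_limit:
  assumes "uniform_limit {z. infdist z (trunc n) < e} (\<lambda>i. poly (P i)) h G" "e > 0"
    "h holomorphic_on {z. infdist z (trunc n) < e}"
  shows "uniform_limit (trunc n) (\<lambda>i. D l (poly_fun (P i))) ((deriv ^^ l) h) G"
proof -
  have "uniform_limit (trunc n) (\<lambda>i. (deriv ^^ l) (poly (P i))) ((deriv ^^ l) h) G"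
    by (rule uniform_limit_higher_deriv[OF assms(2,1) _ assms(3)]) (simp add: poly_holomorphic)
  moreover have "D l (poly_fun (P i)) z = (deriv ^^ l) (poly (P i)) z" if "z \<in> trunc n" for i z
    using that trunc_subset poly_fun(2) by blast
  ultimately show ?thesis
    using uniform_limit_cong'[of "trunc n" "\<lambda>i. D l (poly_fun (P i))" "\<lambda>i. (deriv ^^ l) (poly (P i))"
        "(deriv ^^ l) h" "(deriv ^^ l) h" G] by simp
qed

lemma H_closure_subset: "H_closure \<Omega> \<subseteq> A"
  unfolding H_closure_def using restrict_holomorphic(1) by blast

text \<open>For each n, Runge's theorem near the n-th piece yields a polynomial within 1 / (n + 1)
  in all derivatives up to order n. As pieces and orders grow with n, these polynomials converge in
  the metric.\<close>

lemma polynomials_dense: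
  assumes con: "\<And>n. connected (- trunc n)"
  shows "H_closure \<Omega> \<subseteq> MS.mtopology closure_of (range poly_fun)"
proof
  fix f assume "f \<in> H_closure \<Omega>"
  then obtain h U where f: "f = restrict h \<Omega>" and U: "open U" "closure \<Omega> \<subseteq> U" "h holomorphic_on U"
    unfolding H_closure_def by blast
  have fA: "f \<in> A" and Df: "\<And>l z. z \<in> closure \<Omega> \<Longrightarrow> D l f z = (deriv ^^ l) h z"
    using restrict_holomorphic[OF U] by (auto simp: f)
  have "\<exists>P. \<forall>l\<le>n. \<forall>z\<in>trunc n. dist (D l (poly_fun P) z) (D l f z) < 1 / Suc n" for n
  proof -
    have ne: "trunc n \<noteq> {}" using zero_in_trunc by blast
    obtain \<delta> where \<delta>: "\<delta> > 0" "{z. infdist z (trunc n) \<le> \<delta>} \<subseteq> U"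
      "h \<in> uniform_poly_limits {z. infdist z (trunc n) \<le> \<delta>}"
      using Runge_polynomial[OF compact_trunc ne con U(1) subset_trans[OF trunc_subset U(2)] U(3)] .
    let ?L = "{z. infdist z (trunc n) \<le> \<delta>}" and ?L' = "{z. infdist z (trunc n) < \<delta>}"
    have "\<exists>P. \<forall>z\<in>?L. norm (h z - poly P z) < 1 / Suc i" for i
      using \<delta>(3) unfolding uniform_poly_limits_def by (auto simp del: of_nat_Suc)
    then obtain P where P: "\<And>i z. z \<in> ?L \<Longrightarrow> norm (h z - poly (P i) z) < 1 / Suc i" by metis
    have "uniform_limit ?L' (\<lambda>i. poly (P i)) h sequentially"
    proof (rule uniform_limitI)
      fix \<epsilon> :: real assume "\<epsilon> > 0"
      then have "\<forall>\<^sub>F i in sequentially. 1 / real (Suc i) < \<epsilon>"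
        using LIMSEQ_Suc[OF lim_1_over_n] order_tendstoD(2) by blast
      then show "\<forall>\<^sub>F i in sequentially. \<forall>z\<in>?L'. dist (poly (P i) z) (h z) < \<epsilon>"
      proof eventually_elim
        case (elim i)
        show ?case
        proof
          fix z assume "z \<in> ?L'"
          then have "norm (h z - poly (P i) z) < 1 / Suc i" by (intro P) simp
          then show "dist (poly (P i) z) (h z) < \<epsilon>" using elim by (simp add: dist_norm norm_minus_commute)
        qed
      qed
    qed
    moreover have "h holomorphic_on ?L'"
      by (rule holomorphic_on_subset[OF U(3)]) (use \<delta>(2) in force)
    ultimately have lim: "uniform_limit (trunc n) (\<lambda>i. D l (poly_fun (P i))) ((deriv ^^ l) h) sequentially" for l
      by (intro poly_fun_uniform_limit[OF _ \<delta>(1)])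
    have "0 < 1 / real (Suc n)" by simp
    then have "\<forall>\<^sub>F i in sequentially. \<forall>l\<in>{..n}. \<forall>z\<in>trunc n. dist (D l (poly_fun (P i)) z) ((deriv ^^ l) h z) < 1 / Suc n"
      by (intro eventually_ball_finite[OF finite_atMost] ballI[of "{..n}"] uniform_limitD[OF lim])
    then obtain i where "\<forall>l\<in>{..n}. \<forall>z\<in>trunc n. dist (D l (poly_fun (P i)) z) ((deriv ^^ l) h z) < 1 / Suc n"
      using eventually_happens' sequentially_bot by blast
    moreover have "D l f z = (deriv ^^ l) h z" if "z \<in> trunc n" for l z
      using that trunc_subset Df by blast
    ultimately show ?thesis by (intro exI[of _ "P i"]) simp
  qed
  then obtain P where P: "\<And>n l z. l \<le> n \<Longrightarrow> z \<in> trunc n \<Longrightarrow> dist (D l (poly_fun (P n)) z) (D l f z) < 1 / Suc n"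
    by metis
  show "f \<in> MS.mtopology closure_of (range poly_fun)"
  proof (rule closure_of_sequentialI[of "\<lambda>n. poly_fun (P n)", OF _ poly_fun(1) fA])
    fix l n
    show "uniform_limit (trunc n) (\<lambda>i. D l (poly_fun (P i))) (D l f) sequentially"
    proof (rule uniform_limitI)
      fix \<epsilon> :: real assume "\<epsilon> > 0"
      then have "\<forall>\<^sub>F i in sequentially. 1 / real (Suc i) < \<epsilon>"
        using LIMSEQ_Suc[OF lim_1_over_n] order_tendstoD(2) by blast
      then show "\<forall>\<^sub>F i in sequentially. \<forall>z\<in>trunc n. dist (D l (poly_fun (P i)) z) (D l f z) < \<epsilon>"
        using eventually_ge_at_top[of "max n l"]
      proof eventually_elim
        case (elim i)
        show ?case
        proof
          fix z assume "z \<in> trunc n"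
          then have "z \<in> trunc i" using elim(2) trunc_mono[of n i] by auto
          then have "dist (D l (poly_fun (P i)) z) (D l f z) < 1 / Suc i" using elim(2) by (intro P) auto
          then show "dist (D l (poly_fun (P i)) z) (D l f z) < \<epsilon>" using elim(1) by (rule less_trans)
        qed
      qed
    qed
  qed auto
qed

text \<open>The pair (P, 1) solves the linear system, so by uniqueness it is the Cramer pair; the
  error is 0 and there are no poles.\<close>

lemma poly_fun_pade_close:
  assumes "degree P = p" "P \<noteq> 0"
  shows "pade_close s p q (poly_fun P)"
proof -
  have det: "Determinant.det (hankel (fps_of_poly P) p q) \<noteq> 0"
    by (rule det_hankel_poly[OF assms])
  then have reg: "pade_regular (poly_fun P) p q" by (simp add: pade_regular_iff fps_expansion_poly_fun)
  have "pade_system (fps_of_poly P) p q P 1" using assms by (simp add: pade_system_def)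
  then have "pade_num (fps_of_poly P) p q = P" "pade_den (fps_of_poly P) p q = 1"
    using pade_system_unique[OF det] by auto
  then have "rat_eval (pade (poly_fun P) p q) = poly P" "rat_poles (pade (poly_fun P) p q) = {}"
    using pade_regular_pade[OF reg] by (auto simp: fps_expansion_poly_fun)
  moreover have "D l (poly_fun P) z = (deriv ^^ l) (poly P) z" if "z \<in> trunc s" for l z
    using that trunc_subset poly_fun(2) by blast
  ultimately show ?thesis
    unfolding pade_close_def using reg by (intro conjI exI[of _ 0]) auto
qed

text \<open>A polynomial \<open>P\<close> is perturbed by a small multiple of \<open>z\<^sup>p\<close> with \<open>p > degree P\<close>: the perturbed
  polynomial has degree exactly \<open>p\<close>, so its Hankel matrix is anti-triangular and it is its own
  \<open>[p/q]\<close> Pade approximant.\<close>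

lemma pade_close_set_dense:
  assumes "\<And>n. \<exists>p q. n < p \<and> (p, q) \<in> F"
  shows "range poly_fun \<subseteq> MS.mtopology closure_of (pade_close_set F s \<inter> H_closure \<Omega>)"
proof
  fix f assume "f \<in> range poly_fun"
  then obtain P where f: "f = poly_fun P" by blast
  obtain p q where pq: "degree P < p" "(p, q) \<in> F" using assms by blast
  define P' where "P' = (\<lambda>i. P + monom (1 / of_nat (Suc i)) p)"
  have coeff: "poly.coeff (P' i) v = (if v = p then 1 / of_nat (Suc i) else poly.coeff P v)" for i v
    using pq(1) by (auto simp: P'_def coeff_eq_0)
  have deg: "degree (P' i) = p" for i
  proof (rule antisym)
    show "degree (P' i) \<le> p" using pq(1) by (intro degree_le) (auto simp: coeff coeff_eq_0)
    show "p \<le> degree (P' i)" by (intro le_degree) (simp add: coeff del: of_nat_Suc)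
  qed
  have ne: "P' i \<noteq> 0" for i using deg[of i] pq(1) by auto
  have lim: "(\<lambda>i. poly.coeff (P' i) v) \<longlonglongrightarrow> poly.coeff P v" for v
  proof (cases "v = p")
    case True
    have "(\<lambda>i. 1 / of_nat (Suc i) :: complex) \<longlonglongrightarrow> 0"
      by (rule LIMSEQ_Suc[OF lim_1_over_n])
    then show ?thesis using True pq(1) by (simp add: coeff coeff_eq_0)
  qed (simp add: coeff)
  show "f \<in> MS.mtopology closure_of (pade_close_set F s \<inter> H_closure \<Omega>)"
  proof (rule closure_of_sequentialI[of "\<lambda>i. poly_fun (P' i)"])
    show "poly_fun (P' i) \<in> pade_close_set F s \<inter> H_closure \<Omega>" for i
      using poly_fun_pade_close[OF deg ne, of s q i] pq(2) poly_fun(1) poly_fun_in_H_closure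
      unfolding pade_close_set_def by blast
    fix l n
    have "trunc n \<noteq> {}" using zero_in_trunc by blast
    \<comment> \<open>Polynomials are entire, so any radius would serve for the neighbourhood; it
      only has to be bounded for coefficientwise convergence to be uniform.\<close>
    then have "compact {z. infdist z (trunc n) \<le> 1}" by (intro compact_infdist_le compact_trunc) auto
    then have "bounded {z. infdist z (trunc n) < 1}"
      by (rule bounded_subset[OF compact_imp_bounded]) auto
    then have "uniform_limit {z. infdist z (trunc n) < 1} (\<lambda>i. poly (P' i)) (poly P) sequentially"
      using pq(1) by (intro uniform_limit_poly[of _ p] lim) (auto simp: deg)
    then have "uniform_limit (trunc n) (\<lambda>i. D l (poly_fun (P' i))) ((deriv ^^ l) (poly P)) sequentially"
      by (rule poly_fun_uniform_limit) (auto simp: poly_holomorphic)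
    moreover have "D l f z = (deriv ^^ l) (poly P) z" if "z \<in> trunc n" for z
      using that trunc_subset poly_fun(2) f by blast
    ultimately show "uniform_limit (trunc n) (\<lambda>i. D l (poly_fun (P' i))) (D l f) sequentially"
      using uniform_limit_cong'[of "trunc n" "\<lambda>i. D l (poly_fun (P' i))" "\<lambda>i. D l (poly_fun (P' i))"
        "D l f" "(deriv ^^ l) (poly P)" sequentially] by simp
  qed (use f poly_fun(1) in auto)
qed

end

theorem theorem3p4:
  fixes \<Omega> :: "complex set" and F :: "(nat \<times> nat) set"
    and X B :: "(complex \<Rightarrow> complex) set"
  assumes "open \<Omega>" and "0 \<in> \<Omega>"
    and "connectedin (Alexandroff_compactification (euclidean :: complex topology))
           (topspace (Alexandroff_compactification (euclidean :: complex topology))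
              - Some ` closure \<Omega>)"
    and "\<exists>p q :: nat \<Rightarrow> nat. (\<forall>m. (p m, q m) \<in> F) \<and> filterlim p at_top sequentially"
  defines "X \<equiv> A_infty_topology \<Omega> closure_of H_closure \<Omega>"
    and "B \<equiv> pade_convergent \<Omega> F"
  shows "gdelta_in (subtopology (A_infty_topology \<Omega>) X) (B \<inter> X) \<and>
         subtopology (A_infty_topology \<Omega>) X closure_of (B \<inter> X) = X \<and>
         B \<noteq> {}"
proof -
  interpret A_infty_domain \<Omega> using assms(1,2) by unfold_locales
  let ?T = "MS.mtopology"
  let ?E = "pade_close_set F"
  define S where "S = subtopology ?T X"
  have X: "X = ?T closure_of H_closure \<Omega>" by (simp add: X_def A_infty_topology_eq)
  have HX: "H_closure \<Omega> \<subseteq> X" unfolding X using H_closure_subset by (intro closure_of_subset) simp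
  have XA: "X \<subseteq> A" unfolding X using closure_of_subset_topspace[of ?T] by simp
  have topS: "topspace S = X" using XA by (auto simp: S_def)
  have large: "\<exists>p q. n < p \<and> (p, q) \<in> F" for n
  proof -
    obtain p q :: "nat \<Rightarrow> nat" where pq: "\<And>k. (p k, q k) \<in> F" "filterlim p at_top sequentially"
      using assms(4) by blast
    have "\<forall>\<^sub>F k in sequentially. n < p k" by (rule eventually_compose_filterlim[OF eventually_gt_at_top pq(2)])
    then obtain k where "n < p k" using eventually_happens' sequentially_bot by blast
    then show ?thesis using pq(1)[of k] by blast
  qed
  have con: "connected (- trunc n)" for n
    unfolding trunc_def by (rule connected_Compl_Int_cball[OF closed_closure assms(3)])
  \<comment> \<open>Density is transported along closures: from polynomials to functions holomorphic
    near the closure, and from these to X. The perturbed polynomials lie in X themselves, so the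
    density holds inside X.\<close>
  have dense: "X \<subseteq> ?T closure_of (?E s \<inter> X)" for s
  proof -
    have "?T closure_of (?E s \<inter> H_closure \<Omega>) \<subseteq> ?T closure_of (?E s \<inter> X)"
      using HX by (intro closure_of_mono) blast
    then have "range poly_fun \<subseteq> ?T closure_of (?E s \<inter> X)"
      using pade_close_set_dense[OF large, of s] by blast
    then have "?T closure_of (range poly_fun) \<subseteq> ?T closure_of (?E s \<inter> X)"
      by (intro closure_of_minimal) simp_all
    then have "H_closure \<Omega> \<subseteq> ?T closure_of (?E s \<inter> X)"
      using polynomials_dense[OF con] by blast
    then show ?thesis unfolding X by (intro closure_of_minimal) simp_all
  qed
  have BX: "B \<inter> X = \<Inter> (range (\<lambda>s. ?E s \<inter> X))"
    unfolding B_def pade_convergent_eq by blast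
  have opE: "openin S (?E s \<inter> X)" for s
    unfolding S_def by (intro openin_subtopology_Int openin_pade_close_set)
  have clE: "S closure_of (?E s \<inter> X) = X" for s
  proof -
    have "X \<inter> (?E s \<inter> X) = ?E s \<inter> X" by blast
    then show ?thesis using dense[of s] unfolding S_def closure_of_subtopology by auto
  qed
  \<comment> \<open>X is closed in a complete metric space, which makes Baire's theorem available in
    its relative topology.\<close>
  have "completely_metrizable_space S"
    unfolding S_def X
    by (intro completely_metrizable_space_closedin MS.completely_metrizable_space_mtopology A_infty_complete) simp
  then have "S closure_of \<Inter> (range (\<lambda>s. ?E s \<inter> X)) = topspace S"
    by (intro Baire_category) (auto simp: opE clE topS)
  then have cl: "S closure_of (B \<inter> X) = X" by (simp add: BX topS)
  have "gdelta_in S (B \<inter> X)"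
    unfolding BX by (intro gdelta_in_Inter) (auto intro: open_imp_gdelta_in opE)
  moreover have "B \<noteq> {}"
  proof
    assume "B = {}"
    then have "X = {}" using cl by simp
    then show False using HX poly_fun_in_H_closure by blast
  qed
  ultimately show ?thesis using cl by (simp add: S_def A_infty_topology_eq)
qed

end
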